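(* Let $\Bbbk$ be a field of characteristic $0$, let $R$ be a $\Bbbk$-algebra, let $H$ be a connected Hopf $\Bbbk$-algebra, and let $S \subseteq \operatorname{Hom}_\Bbbk(H,R)$ be a subring of the convolution algebra such that $u^*(S) = R$, where $u^* \colon \operatorname{Hom}_\Bbbk(H,R) \to R$ is the algebra map $f \mapsto f(1)$. If $R$ is prime (respectively semiprime, a domain), then $S$ is prime (respectively semiprime, a domain).
   Context: Algebras are associative with $1$, not necessarily commutative; domains need not be commutative. A Hopf algebra $H$ over $\Bbbk$, with comultiplication $\Delta(h) = h_1 \otimes h_2$ (Sweedler notation), is connected if its coradical (the sum of all its simple subcoalgebras) is $\Bbbk = \Bbbk 1$. The convolution algebra $\operatorname{Hom}_\Bbbk(H,R)$ is the $\Bbbk$-algebra of all $\Bbbk$-linear maps $H \to R$ with multiplication $(f*g)(h) = f(h_1)g(h_2)$ for $f,g \in \operatorname{Hom}_\Bbbk(H,R)$, $h \in H$. *)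

theory Defs
  imports
    "HOL-Library.Poly_Mapping"
    "HOL-Algebra.Subrings"
    "HOL-Algebra.Ideal_Product"
begin

section \<open>Noncommutative rings\<close>

text \<open>
  The library's \<open>domain\<close> and \<open>primeideal\<close> are restricted to commutative rings, so the
  noncommutative notions are defined here. \<open>ideal\<close> is the library's two-sided ideal. Prime rings and
  domains are nonzero by definition; the zero ring is semiprime.
\<close>

definition prime_ring :: "('a, 'm) ring_scheme \<Rightarrow> bool" where
  "prime_ring R \<longleftrightarrow> ring R \<and> carrier R \<noteq> {\<zero>\<^bsub>R\<^esub>} \<and>
     (\<forall>I J. ideal I R \<longrightarrow> ideal J R \<longrightarrow> ideal_prod R I J = {\<zero>\<^bsub>R\<^esub>} \<longrightarrow>
        I = {\<zero>\<^bsub>R\<^esub>} \<or> J = {\<zero>\<^bsub>R\<^esub>})"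

definition semiprime_ring :: "('a, 'm) ring_scheme \<Rightarrow> bool" where
  "semiprime_ring R \<longleftrightarrow> ring R \<and>
     (\<forall>I. ideal I R \<longrightarrow> ideal_prod R I I = {\<zero>\<^bsub>R\<^esub>} \<longrightarrow> I = {\<zero>\<^bsub>R\<^esub>})"

definition noncomm_domain :: "('a, 'm) ring_scheme \<Rightarrow> bool" where
  "noncomm_domain R \<longleftrightarrow> ring R \<and> \<one>\<^bsub>R\<^esub> \<noteq> \<zero>\<^bsub>R\<^esub> \<and>
     (\<forall>a\<in>carrier R. \<forall>b\<in>carrier R. a \<otimes>\<^bsub>R\<^esub> b = \<zero>\<^bsub>R\<^esub> \<longrightarrow> a = \<zero>\<^bsub>R\<^esub> \<or> b = \<zero>\<^bsub>R\<^esub>)"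

text \<open>The sort \<open>{ring, monoid_mult}\<close> (unlike \<open>ring_1\<close>) does not exclude the zero ring; for the same
  reason the library's \<open>ring_of_type_algebra\<close> is not used.\<close>

definition ring_of_type :: "'r::{ring, monoid_mult} ring" where
  "ring_of_type = \<lparr>carrier = UNIV, mult = (*), one = 1, zero = 0, add = (+)\<rparr>"


section \<open>Equality in tensor powers of a vector space\<close>

text \<open>
  The list \<open>[(a\<^sub>1, b\<^sub>1), \<dots>, (a\<^sub>n, b\<^sub>n)]\<close> denotes the tensor \<open>a\<^sub>1 \<otimes> b\<^sub>1 + \<dots> + a\<^sub>n \<otimes> b\<^sub>n\<close> of \<open>V \<otimes> V\<close>;
  lists of triples denote elements of \<open>V \<otimes> V \<otimes> V\<close>. Every tensor is of this form. The tensor powers are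
  the usual quotients of the free vector space \<open>'p \<Rightarrow>\<^sub>0 'k\<close> on the pairs (triples) by the span of the
  relations expressing linearity in each entry, and two lists denote the same tensor iff the
  corresponding elements of the free vector space agree modulo these relations.
\<close>

definition free_scale :: "'k::field \<Rightarrow> ('p \<Rightarrow>\<^sub>0 'k) \<Rightarrow> ('p \<Rightarrow>\<^sub>0 'k)" where
  "free_scale c = Poly_Mapping.map ((*) c)"

definition formal_sum :: "'p list \<Rightarrow> ('p \<Rightarrow>\<^sub>0 'k::field)" where
  "formal_sum ps = (\<Sum>p\<leftarrow>ps. Poly_Mapping.single p 1)"

text \<open>In \<open>slot_relations\<close>, the map \<open>\<iota>\<close> fills one entry of a tuple whose other entries are fixed.\<close>

definition slot_relations ::
    "('k::field \<Rightarrow> 'v::ab_group_add \<Rightarrow> 'v) \<Rightarrow> ('v \<Rightarrow> 'p) \<Rightarrow> ('p \<Rightarrow>\<^sub>0 'k) set" where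
  "slot_relations scale \<iota> =
     {Poly_Mapping.single (\<iota> (a + b)) 1 - Poly_Mapping.single (\<iota> a) 1 - Poly_Mapping.single (\<iota> b) 1
       | a b. True} \<union>
     {Poly_Mapping.single (\<iota> (scale c a)) 1 - Poly_Mapping.single (\<iota> a) c | c a. True}"

definition tensor2_eq ::
    "('k::field \<Rightarrow> 'v::ab_group_add \<Rightarrow> 'v) \<Rightarrow> ('v \<times> 'v) list \<Rightarrow> ('v \<times> 'v) list \<Rightarrow> bool" where
  "tensor2_eq scale xs ys \<longleftrightarrow>
     formal_sum xs - formal_sum ys \<in> module.span free_scale
       ((\<Union>b. slot_relations scale (\<lambda>a. (a, b))) \<union>
        (\<Union>a. slot_relations scale (\<lambda>b. (a, b))))"

definition tensor3_eq ::
    "('k::field \<Rightarrow> 'v::ab_group_add \<Rightarrow> 'v) \<Rightarrow> ('v \<times> 'v \<times> 'v) list \<Rightarrow> ('v \<times> 'v \<times> 'v) list \<Rightarrow> bool" where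
  "tensor3_eq scale xs ys \<longleftrightarrow>
     formal_sum xs - formal_sum ys \<in> module.span free_scale
       ((\<Union>b c. slot_relations scale (\<lambda>a. (a, b, c))) \<union>
        (\<Union>a c. slot_relations scale (\<lambda>b. (a, b, c))) \<union>
        (\<Union>a b. slot_relations scale (\<lambda>c. (a, b, c))))"


section \<open>Algebras, coalgebras and Hopf algebras\<close>

locale assoc_algebra = vector_space scale
  for scale :: "'k::field \<Rightarrow> 'a::{ring, monoid_mult} \<Rightarrow> 'a" (infixr \<open>*s\<close> 75) +
  assumes scale_mult_left: "(c *s x) * y = c *s (x * y)"
    and scale_mult_right: "x * (c *s y) = c *s (x * y)"

text \<open>
  \<open>\<Delta> x\<close> is a representing list \<open>[(x\<^sub>1, x\<^sub>2), \<dots>]\<close> of the comultiplication of \<open>x\<close> (Sweedler notation). The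
  choice of representatives is irrelevant: all axioms are equalities of tensors, or values of linear
  maps on tensors.
\<close>

locale coalgebra = vector_space scale
  for scale :: "'k::field \<Rightarrow> 'h::ab_group_add \<Rightarrow> 'h" (infixr \<open>*s\<close> 75) +
  fixes \<Delta> :: "'h \<Rightarrow> ('h \<times> 'h) list"
    and \<epsilon> :: "'h \<Rightarrow> 'k"
  assumes comult_add: "tensor2_eq scale (\<Delta> (x + y)) (\<Delta> x @ \<Delta> y)"
    and comult_scale: "tensor2_eq scale (\<Delta> (c *s x)) [(c *s a, b). (a, b) \<leftarrow> \<Delta> x]"
    and counit_linear: "Vector_Spaces.linear scale (*) \<epsilon>"
    and coassoc: "tensor3_eq scale [(a\<^sub>1, a\<^sub>2, b). (a, b) \<leftarrow> \<Delta> x, (a\<^sub>1, a\<^sub>2) \<leftarrow> \<Delta> a]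
                                   [(a, b\<^sub>1, b\<^sub>2). (a, b) \<leftarrow> \<Delta> x, (b\<^sub>1, b\<^sub>2) \<leftarrow> \<Delta> b]"
    and counit_left: "(\<Sum>(a, b)\<leftarrow>\<Delta> x. \<epsilon> a *s b) = x"
    and counit_right: "(\<Sum>(a, b)\<leftarrow>\<Delta> x. \<epsilon> b *s a) = x"
begin

definition subcoalgebra :: "'h set \<Rightarrow> bool" where
  "subcoalgebra C \<longleftrightarrow> subspace C \<and>
     (\<forall>x\<in>C. \<exists>xs. set xs \<subseteq> C \<times> C \<and> tensor2_eq scale (\<Delta> x) xs)"

definition simple_subcoalgebra :: "'h set \<Rightarrow> bool" where
  "simple_subcoalgebra C \<longleftrightarrow> subcoalgebra C \<and> C \<noteq> {0} \<and>
     (\<forall>D. subcoalgebra D \<and> D \<subseteq> C \<longrightarrow> D = {0} \<or> D = C)"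

definition coradical :: "'h set" where
  "coradical = span (\<Union>{C. simple_subcoalgebra C})"

end

locale hopf_algebra =
  assoc_algebra scale + coalgebra scale \<Delta> \<epsilon>
  for scale :: "'k::field \<Rightarrow> 'h::{ring, monoid_mult} \<Rightarrow> 'h" (infixr \<open>*s\<close> 75)
    and \<Delta> :: "'h \<Rightarrow> ('h \<times> 'h) list"
    and \<epsilon> :: "'h \<Rightarrow> 'k" +
  fixes antipode :: "'h \<Rightarrow> 'h"
  assumes comult_one: "tensor2_eq scale (\<Delta> 1) [(1, 1)]"
    and comult_mult:
      "tensor2_eq scale (\<Delta> (x * y)) [(a * c, b * d). (a, b) \<leftarrow> \<Delta> x, (c, d) \<leftarrow> \<Delta> y]"
    and counit_one: "\<epsilon> 1 = 1"
    and counit_mult: "\<epsilon> (x * y) = \<epsilon> x * \<epsilon> y"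
    and antipode_linear: "Vector_Spaces.linear scale scale antipode"
    and antipode_left: "(\<Sum>(a, b)\<leftarrow>\<Delta> x. antipode a * b) = \<epsilon> x *s 1"
    and antipode_right: "(\<Sum>(a, b)\<leftarrow>\<Delta> x. a * antipode b) = \<epsilon> x *s 1"

locale connected_hopf_algebra = hopf_algebra +
  assumes connected: "coradical = range (\<lambda>c. scale c 1)"


section \<open>The convolution algebra\<close>

definition convolution_algebra ::
    "('k::field \<Rightarrow> 'h::ab_group_add \<Rightarrow> 'h) \<Rightarrow> ('h \<Rightarrow> ('h \<times> 'h) list) \<Rightarrow> ('h \<Rightarrow> 'k) \<Rightarrow>
     ('k \<Rightarrow> 'r::{ring, monoid_mult} \<Rightarrow> 'r) \<Rightarrow> ('h \<Rightarrow> 'r) ring" where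
  "convolution_algebra smultH \<Delta> \<epsilon> smultR =
     \<lparr>carrier = {f. Vector_Spaces.linear smultH smultR f},
      mult = (\<lambda>f g h. \<Sum>(a, b)\<leftarrow>\<Delta> h. f a * g b),
      one = (\<lambda>h. smultR (\<epsilon> h) 1),
      zero = (\<lambda>h. 0),
      add = (\<lambda>f g h. f h + g h)\<rparr>"

end

theory Submission
  imports Defs "HOL-Library.Multiset_Order"
begin

text \<open>
  The right coideal generated by an element of a connected coalgebra has a basis in which every
  functional \<open>\<phi>\<close> acts by a triangular matrix with diagonal entries \<open>\<phi>(1)\<close>. Its matrix coefficients
  therefore form unitriangular matrices; call those above the diagonal letters, graded by their
  distance from it. Letters and \<open>1\<close> span \<open>H\<close>, and \<open>\<Delta>\<close> maps a product of letters to the sum over all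
  ways of splitting it into two subwords, plus tensors of the same total degree involving more letters.

  Given \<open>f, g \<noteq> 0\<close> in \<open>S\<close>, consider words of minimal degree, and among those of maximal length, on
  which \<open>f\<close> (respectively \<open>g\<close>) does not vanish; on the products of such words convolution only sees
  the splittings. Taking sorted words that are maximal in the multiset order leaves a single type of
  splitting, so \<open>f * s * g\<close> takes the value \<open>c f(x) s(1) g(y)\<close> with a positive integer \<open>c\<close>,
  \<open>f(x) \<noteq> 0\<close> and \<open>g(y) \<noteq> 0\<close>, where \<open>x = y\<close> if \<open>f = g\<close>. Since \<open>s(1)\<close> ranges over \<open>R\<close>, each of the
  three properties passes from \<open>R\<close> to \<open>S\<close>.
\<close>

section \<open>Linear functionals and tensors\<close>

lemma vector_space_field: "vector_space ((*) :: 'k::field \<Rightarrow> 'k \<Rightarrow> 'k)"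
  by unfold_locales (simp_all add: algebra_simps)

lemma sum_list_linear:
  assumes "Vector_Spaces.linear s1 s2 f"
  shows "f (\<Sum>x\<leftarrow>xs. g x) = (\<Sum>x\<leftarrow>xs. f (g x))"
proof -
  interpret Vector_Spaces.linear s1 s2 f by fact
  show ?thesis by (induction xs) (simp_all add: zero add)
qed

lemma linear_sum_list:
  assumes "vector_space s1" "vector_space s2"
    and "\<And>x. x \<in> set xs \<Longrightarrow> Vector_Spaces.linear s1 s2 (f x)"
  shows "Vector_Spaces.linear s1 s2 (\<lambda>v. \<Sum>x\<leftarrow>xs. f x v)"
proof -
  interpret vector_space_pair s1 s2 by (rule vector_space_pair.intro; fact)
  show ?thesis
    using assms(3) by (induction xs) (simp_all add: linear_zero linear_compose_add)
qed

text \<open>A basis of \<open>W\<close> stays independent after adjoining \<open>x\<close>, so the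
  values 0 on \<open>W\<close> and 1 at \<open>x\<close> extend linearly. This turns membership in a
  subspace into equations between scalars.\<close>

lemma (in vector_space) separating_functional:
  assumes W: "subspace W" and x: "x \<notin> W"
  obtains \<phi> where "Vector_Spaces.linear scale (*) \<phi>" "\<And>w. w \<in> W \<Longrightarrow> \<phi> w = 0" "\<phi> x = 1"
proof -
  interpret vp: vector_space_pair scale "(*)"
    by (rule vector_space_pair.intro[OF vector_space_axioms vector_space_field])
  obtain B where B: "B \<subseteq> W" "independent B" "W \<subseteq> span B"
    by (rule basis_exists)
  have "span B \<subseteq> W"
    using B(1) W by (rule span_minimal)
  with x have "x \<notin> span B" by blast
  then have "independent (insert x B)" and xB: "x \<notin> B"
    using independent_insertI[OF _ B(2)] span_base by auto
  from vp.linear_independent_extend[OF this(1), of "\<lambda>v. if v = x then 1 else 0"]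
  obtain \<phi> where \<phi>: "Vector_Spaces.linear scale (*) \<phi>"
      "\<forall>v\<in>insert x B. \<phi> v = (if v = x then 1 else 0)"
    by (elim exE conjE)
  have "\<phi> w = 0" if "w \<in> W" for w
  proof (rule vp.linear_eq_0_on_span[OF \<phi>(1)])
    show "\<phi> v = 0" if "v \<in> B" for v
      using \<phi>(2) xB that by auto
    show "w \<in> span B" using B(3) that by blast
  qed
  moreover have "\<phi> x = 1"
    using \<phi>(2) by simp
  ultimately show thesis
    using that[OF \<phi>(1)] by blast
qed

text \<open>Coordinate functionals of \<open>E\<close>, extended to the whole space. The expansion
  compares two linear maps that agree on \<open>E\<close>, hence on its span.\<close>

lemma (in vector_space) dual_basis:
  assumes "finite E" "independent E"
  obtains \<phi> where "\<And>e. Vector_Spaces.linear scale (*) (\<phi> e)"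
    "\<And>e e'. e \<in> E \<Longrightarrow> e' \<in> E \<Longrightarrow> \<phi> e e' = (if e = e' then 1 else 0)"
    "\<And>v. v \<in> span E \<Longrightarrow> v = (\<Sum>e\<in>E. scale (\<phi> e v) e)"
proof -
  interpret vp: vector_space_pair scale "(*)"
    by (rule vector_space_pair.intro[OF vector_space_axioms vector_space_field])
  interpret vq: vector_space_pair scale scale
    by (rule vector_space_pair.intro[OF vector_space_axioms vector_space_axioms])
  have "\<exists>\<phi>. Vector_Spaces.linear scale (*) \<phi> \<and> (\<forall>e'\<in>E. \<phi> e' = (if e = e' then 1 else 0))" for e
    using vp.linear_independent_extend[OF assms(2), of "\<lambda>e'. if e = e' then 1 else 0"] by blast
  then obtain \<phi> where \<phi>: "\<And>e. Vector_Spaces.linear scale (*) (\<phi> e)"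
      "\<And>e e'. e' \<in> E \<Longrightarrow> \<phi> e e' = (if e = e' then 1 else 0)"
    by metis
  have lin: "Vector_Spaces.linear scale scale (\<lambda>v. \<Sum>e\<in>E. scale (\<phi> e v) e)"
    using \<phi>(1) by (intro vq.linear_compose_sum)
      (auto simp: Vector_Spaces.linear_iff algebra_simps vector_space_axioms)
  have "(\<Sum>e\<in>E. scale (\<phi> e v) e) = v" if "v \<in> E" for v
  proof -
    have "(\<Sum>e\<in>E. scale (\<phi> e v) e) = (\<Sum>e\<in>E. if e = v then v else 0)"
      using that by (intro sum.cong) (auto simp: \<phi>(2))
    then show ?thesis using that assms(1) by simp
  qed
  then have "v = (\<Sum>e\<in>E. scale (\<phi> e v) e)" if "v \<in> span E" for v
    using vq.linear_eq_on[OF lin linear_ident that] by auto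
  with \<phi> show thesis by (rule that)
qed

section \<open>Linear extension from the free vector space\<close>

lemma lookup_free_scale: "Poly_Mapping.lookup (free_scale c p) x = c * Poly_Mapping.lookup p x"
  by (simp add: free_scale_def Poly_Mapping.map.rep_eq when_def)

lemma free_scale_single: "free_scale c (Poly_Mapping.single x d) = Poly_Mapping.single x (c * d)"
  by (simp add: free_scale_def)

lemma vector_space_free_scale: "vector_space (free_scale :: 'k::field \<Rightarrow> ('p \<Rightarrow>\<^sub>0 'k) \<Rightarrow> _)"
  by unfold_locales
    (auto intro!: poly_mapping_eqI simp: lookup_free_scale lookup_add algebra_simps)

definition linear_lift :: "('k::field \<Rightarrow> 'w::ab_group_add \<Rightarrow> 'w) \<Rightarrow> ('p \<Rightarrow> 'w) \<Rightarrow> ('p \<Rightarrow>\<^sub>0 'k) \<Rightarrow> 'w" where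
  "linear_lift sW h p = (\<Sum>x\<in>Poly_Mapping.keys p. sW (Poly_Mapping.lookup p x) (h x))"

context vector_space
begin

text \<open>Keys may cancel under addition and scaling; a common finite superset of the supports
  makes the sums comparable.\<close>

lemma linear_lift_superset:
  assumes "finite K" "Poly_Mapping.keys p \<subseteq> K"
  shows "linear_lift scale h p = (\<Sum>x\<in>K. scale (Poly_Mapping.lookup p x) (h x))"
  unfolding linear_lift_def using assms
  by (intro sum.mono_neutral_left) (auto simp: in_keys_iff)

lemma linear_lift_add: "linear_lift scale h (p + q) = linear_lift scale h p + linear_lift scale h q"
proof -
  let ?K = "Poly_Mapping.keys p \<union> Poly_Mapping.keys q"
  have "Poly_Mapping.keys (p + q) \<subseteq> ?K" by (rule Poly_Mapping.keys_add)
  then show ?thesis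
    by (simp add: linear_lift_superset[of ?K] lookup_add scale_left_distrib sum.distrib)
qed

lemma linear_lift_scale: "linear_lift scale h (free_scale c p) = scale c (linear_lift scale h p)"
proof -
  have "Poly_Mapping.keys (free_scale c p) \<subseteq> Poly_Mapping.keys p"
    by (auto simp: in_keys_iff lookup_free_scale)
  then show ?thesis
    by (simp add: linear_lift_superset[of "Poly_Mapping.keys p"] lookup_free_scale scale_sum_right)
qed

lemma linear_linear_lift: "Vector_Spaces.linear free_scale scale (linear_lift scale h)"
  by (simp add: Vector_Spaces.linear_iff vector_space_free_scale vector_space_axioms
      linear_lift_add linear_lift_scale)

lemma linear_lift_single [simp]: "linear_lift scale h (Poly_Mapping.single x c) = scale c (h x)"
  by (simp add: linear_lift_superset[of "{x}"])

lemma linear_lift_formal_sum: "linear_lift scale h (formal_sum ps) = (\<Sum>p\<leftarrow>ps. h p)"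
proof -
  have "linear_lift scale h 0 = 0" by (simp add: linear_lift_def)
  then show ?thesis
    by (induction ps) (simp_all add: formal_sum_def linear_lift_add)
qed

lemma linear_lift_slot_relation:
  assumes "Vector_Spaces.linear sV scale (\<lambda>a. h (\<iota> a))" "p \<in> slot_relations sV \<iota>"
  shows "linear_lift scale h p = 0"
proof -
  interpret l: Vector_Spaces.linear free_scale scale "linear_lift scale h" by (rule linear_linear_lift)
  show ?thesis
    using assms by (auto simp: slot_relations_def l.diff Vector_Spaces.linear_iff)
qed

text \<open>Universal property of the quotient: a linear extension that kills the relations kills
  their span.\<close>

lemma formal_sum_congruent:
  assumes "formal_sum xs - formal_sum ys \<in> module.span free_scale X"
    and "\<And>p. p \<in> X \<Longrightarrow> linear_lift scale h p = 0"
  shows "(\<Sum>p\<leftarrow>xs. h p) = (\<Sum>p\<leftarrow>ys. h p)"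
proof -
  interpret vector_space_pair free_scale scale
    by (rule vector_space_pair.intro[OF vector_space_free_scale vector_space_axioms])
  interpret l: Vector_Spaces.linear free_scale scale "linear_lift scale h" by (rule linear_linear_lift)
  have "linear_lift scale h (formal_sum xs - formal_sum ys) = 0"
    using linear_eq_0_on_span[OF linear_linear_lift assms(2) assms(1)] .
  then show ?thesis by (simp add: l.diff linear_lift_formal_sum)
qed

end

section \<open>Bilinear forms as tests for equality of tensors\<close>

definition bilinear_map ::
    "('k::field \<Rightarrow> 'v::ab_group_add \<Rightarrow> 'v) \<Rightarrow> ('k \<Rightarrow> 'w::ab_group_add \<Rightarrow> 'w) \<Rightarrow> ('v \<Rightarrow> 'v \<Rightarrow> 'w) \<Rightarrow> bool" where
  "bilinear_map sV sW B \<longleftrightarrow>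
     (\<forall>b. Vector_Spaces.linear sV sW (\<lambda>a. B a b)) \<and> (\<forall>a. Vector_Spaces.linear sV sW (B a))"

lemma bilinear_mapI:
  assumes "vector_space sV" "vector_space sW"
    and "\<And>a a' b. B (a + a') b = B a b + B a' b" "\<And>c a b. B (sV c a) b = sW c (B a b)"
    and "\<And>a b b'. B a (b + b') = B a b + B a b'" "\<And>c a b. B a (sV c b) = sW c (B a b)"
  shows "bilinear_map sV sW B"
  using assms by (simp add: bilinear_map_def Vector_Spaces.linear_iff)

lemma bilinear_mapD:
  assumes "bilinear_map sV sW B"
  shows "vector_space sV" "vector_space sW"
    and "B (a + a') b = B a b + B a' b" "B (sV c a) b = sW c (B a b)"
    and "B a (b + b') = B a b + B a b'" "B a (sV c b) = sW c (B a b)"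
  using assms by (simp_all add: bilinear_map_def Vector_Spaces.linear_iff)

lemma tensor2_eq_bilinear:
  assumes "tensor2_eq sV xs ys" "bilinear_map sV sW B"
  shows "(\<Sum>(a, b)\<leftarrow>xs. B a b) = (\<Sum>(a, b)\<leftarrow>ys. B a b)"
proof -
  interpret W: vector_space sW using assms(2) by (rule bilinear_mapD)
  show ?thesis
    by (rule W.formal_sum_congruent[OF assms(1)[unfolded tensor2_eq_def]])
      (use assms(2) in \<open>auto simp: bilinear_map_def elim!: W.linear_lift_slot_relation[rotated]\<close>)
qed

lemma tensor3_eq_trilinear:
  assumes "tensor3_eq sV xs ys"
    and "\<And>b c. Vector_Spaces.linear sV sW (\<lambda>a. T a b c)"
    and "\<And>a c. Vector_Spaces.linear sV sW (\<lambda>b. T a b c)"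
    and "\<And>a b. Vector_Spaces.linear sV sW (\<lambda>c. T a b c)"
  shows "(\<Sum>(a, b, c)\<leftarrow>xs. T a b c) = (\<Sum>(a, b, c)\<leftarrow>ys. T a b c)"
proof -
  interpret W: vector_space sW using assms(2) by (simp add: Vector_Spaces.linear_iff)
  show ?thesis
    by (rule W.formal_sum_congruent[OF assms(1)[unfolded tensor3_eq_def]])
      (use assms(2-) in \<open>auto elim!: W.linear_lift_slot_relation[rotated]\<close>)
qed

text \<open>Converse of \<open>tensor2_eq_bilinear\<close>, with scalar-valued forms only. A
  difference outside the span of the relations is detected by a functional on the free vector space,
  and a functional that kills the relations is a bilinear form on pairs.\<close>

lemma tensor2_eqI_bilinear:
  fixes sV :: "'k::field \<Rightarrow> 'v::ab_group_add \<Rightarrow> 'v"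
  assumes V: "vector_space sV"
    and eq: "\<And>B. bilinear_map sV (*) B \<Longrightarrow> (\<Sum>(a, b)\<leftarrow>xs. B a b) = (\<Sum>(a, b)\<leftarrow>ys. B a b)"
  shows "tensor2_eq sV xs ys"
proof (rule ccontr)
  interpret F: vector_space "free_scale :: 'k \<Rightarrow> ('v \<times> 'v \<Rightarrow>\<^sub>0 'k) \<Rightarrow> _"
    by (rule vector_space_free_scale)
  let ?X = "(\<Union>b. slot_relations sV (\<lambda>a. (a, b))) \<union> (\<Union>a. slot_relations sV (\<lambda>b. (a, b)))
     :: ('v \<times> 'v \<Rightarrow>\<^sub>0 'k) set"
  assume "\<not> tensor2_eq sV xs ys"
  then have "formal_sum xs - formal_sum ys \<notin> F.span ?X"
    by (simp add: tensor2_eq_def)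
  then obtain \<Lambda> where \<Lambda>: "Vector_Spaces.linear free_scale (*) \<Lambda>"
      "\<And>w. w \<in> F.span ?X \<Longrightarrow> \<Lambda> w = 0" "\<Lambda> (formal_sum xs - formal_sum ys) = 1"
    by (rule F.separating_functional[OF F.subspace_span]) (rule that)
  interpret \<Lambda>: Vector_Spaces.linear free_scale "(*)" \<Lambda> by fact
  define B where "B a b = \<Lambda> (Poly_Mapping.single (a, b) 1)" for a b
  have rel: "\<Lambda> w = 0" if "w \<in> ?X" for w
    using that by (intro \<Lambda>(2) F.span_base)
  have single: "\<Lambda> (Poly_Mapping.single p c) = c * \<Lambda> (Poly_Mapping.single p 1)" for p c
    using \<Lambda>.scale[of c "Poly_Mapping.single p 1"] by (simp add: free_scale_single)
  have "bilinear_map sV (*) B"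
  proof (rule bilinear_mapI[OF V vector_space_field])
    fix a a' b b' c
    have "Poly_Mapping.single (a + a', b) 1 - Poly_Mapping.single (a, b) 1 - Poly_Mapping.single (a', b) 1 \<in> ?X"
      by (rule UnI1, rule UN_I[of b]) (auto simp: slot_relations_def)
    from rel[OF this] show "B (a + a') b = B a b + B a' b"
      by (simp add: B_def \<Lambda>.diff \<Lambda>.add diff_diff_eq)
    have "Poly_Mapping.single (a, b + b') 1 - Poly_Mapping.single (a, b) 1 - Poly_Mapping.single (a, b') 1 \<in> ?X"
      by (rule UnI2, rule UN_I[of a]) (auto simp: slot_relations_def)
    from rel[OF this] show "B a (b + b') = B a b + B a b'"
      by (simp add: B_def \<Lambda>.diff \<Lambda>.add diff_diff_eq)
    have "Poly_Mapping.single (sV c a, b) 1 - Poly_Mapping.single (a, b) c \<in> ?X"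
      by (rule UnI1, rule UN_I[of b]) (auto simp: slot_relations_def)
    from rel[OF this] show "B (sV c a) b = c * B a b"
      by (simp add: B_def \<Lambda>.diff single[of _ c])
    have "Poly_Mapping.single (a, sV c b) 1 - Poly_Mapping.single (a, b) c \<in> ?X"
      by (rule UnI2, rule UN_I[of a]) (auto simp: slot_relations_def)
    from rel[OF this] show "B a (sV c b) = c * B a b"
      by (simp add: B_def \<Lambda>.diff single[of _ c])
  qed
  from eq[OF this] have "\<Lambda> (formal_sum xs) = \<Lambda> (formal_sum ys)"
    by (simp add: formal_sum_def sum_list_linear[OF \<Lambda>(1)] B_def case_prod_unfold)
  with \<Lambda>(3) show False by (simp add: \<Lambda>.diff)
qed

text \<open>Products of two functionals suffice as tests: on the finite-dimensional span of all
  entries, every bilinear form is a combination of products of coordinate functionals.\<close>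

lemma tensor2_eqI:
  fixes sV :: "'k::field \<Rightarrow> 'v::ab_group_add \<Rightarrow> 'v"
  assumes V: "vector_space sV"
    and eq: "\<And>\<phi> \<psi>. Vector_Spaces.linear sV (*) \<phi> \<Longrightarrow> Vector_Spaces.linear sV (*) \<psi> \<Longrightarrow>
      (\<Sum>(a, b)\<leftarrow>xs. \<phi> a * \<psi> b) = (\<Sum>(a, b)\<leftarrow>ys. \<phi> a * \<psi> b)"
  shows "tensor2_eq sV xs ys"
proof (rule tensor2_eqI_bilinear[OF V])
  interpret V: vector_space sV by fact
  fix B assume B: "bilinear_map sV (*) B"
  define X where "X = fst ` set (xs @ ys) \<union> snd ` set (xs @ ys)"
  obtain E where E: "E \<subseteq> X" "V.independent E" "X \<subseteq> V.span E"
    by (rule V.basis_exists)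
  then have "finite E" by (auto simp: X_def intro: finite_subset)
  obtain \<phi> where
    \<phi>: "\<And>e. Vector_Spaces.linear sV (*) (\<phi> e)" "\<And>v. v \<in> V.span E \<Longrightarrow> v = (\<Sum>e\<in>E. sV (\<phi> e v) e)"
    by (rule V.dual_basis[OF \<open>finite E\<close> E(2)]) (rule that)
  have expand: "B a b = (\<Sum>e\<in>E. \<Sum>e'\<in>E. \<phi> e a * \<phi> e' b * B e e')" if "a \<in> X" "b \<in> X" for a b
  proof -
    have l: "Vector_Spaces.linear sV (*) (\<lambda>a. B a b)" "\<And>a. Vector_Spaces.linear sV (*) (B a)" for b
      using B by (simp_all add: bilinear_map_def)
    interpret L1: Vector_Spaces.linear sV "(*)" "\<lambda>a. B a b" by (rule l)
    have "B a b = B (\<Sum>e\<in>E. sV (\<phi> e a) e) b"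
      using \<phi>(2)[of a] that E(3) by auto
    also have "\<dots> = (\<Sum>e\<in>E. \<phi> e a * B e b)"
      by (simp add: L1.sum L1.scale)
    also have "\<dots> = (\<Sum>e\<in>E. \<phi> e a * B e (\<Sum>e'\<in>E. sV (\<phi> e' b) e'))"
      using \<phi>(2)[of b] that E(3) by auto
    also have "\<dots> = (\<Sum>e\<in>E. \<phi> e a * (\<Sum>e'\<in>E. \<phi> e' b * B e e'))"
    proof (rule sum.cong[OF refl])
      fix e
      interpret L2: Vector_Spaces.linear sV "(*)" "B e" by (rule l)
      show "\<phi> e a * B e (\<Sum>e'\<in>E. sV (\<phi> e' b) e') = \<phi> e a * (\<Sum>e'\<in>E. \<phi> e' b * B e e')"
        by (simp add: L2.sum L2.scale)
    qed
    finally show ?thesis by (simp only: sum_distrib_left mult.assoc)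
  qed
  have main: "(\<Sum>(a, b)\<leftarrow>zs. B a b) = (\<Sum>e\<in>E. \<Sum>e'\<in>E. (\<Sum>(a, b)\<leftarrow>zs. \<phi> e a * \<phi> e' b) * B e e')"
    if "set zs \<subseteq> set (xs @ ys)" for zs
    using that
  proof (induction zs)
    case (Cons z zs)
    obtain a b where z: "z = (a, b)" by fastforce
    then have "a \<in> X" "b \<in> X" using Cons.prems by (force simp: X_def)+
    then show ?case using Cons by (simp add: z expand[of a b] distrib_right sum.distrib)
  qed simp
  show "(\<Sum>(a, b)\<leftarrow>xs. B a b) = (\<Sum>(a, b)\<leftarrow>ys. B a b)"
    using main[of xs] main[of ys] eq[OF \<phi>(1) \<phi>(1)] by simp
qed

section \<open>The dual algebra of a coalgebra and its actions\<close>

context coalgebra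
begin

text \<open>The lists \<open>\<Delta> x\<close> are arbitrary representatives, so linearity in
  \<open>x\<close> holds only for tensors and becomes an equation once a bilinear map is
  applied.\<close>

lemma comult_linear:
  assumes B: "bilinear_map scale sW B"
  shows "Vector_Spaces.linear scale sW (\<lambda>x. \<Sum>(a, b)\<leftarrow>\<Delta> x. B a b)"
proof -
  interpret W: vector_space sW using B by (rule bilinear_mapD)
  have "(\<Sum>(a, b)\<leftarrow>\<Delta> (c *s x). B a b) = sW c (\<Sum>(a, b)\<leftarrow>\<Delta> x. B a b)" for c x
  proof -
    have "(\<Sum>(a, b)\<leftarrow>map (\<lambda>(a, b). (c *s a, b)) zs. B a b) = sW c (\<Sum>(a, b)\<leftarrow>zs. B a b)" for zs
      by (induction zs) (auto simp: bilinear_mapD[OF B] W.scale_right_distrib)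
    then show ?thesis
      using tensor2_eq_bilinear[OF comult_scale B, of c x] by simp
  qed
  moreover have "(\<Sum>(a, b)\<leftarrow>\<Delta> (x + y). B a b) = (\<Sum>(a, b)\<leftarrow>\<Delta> x. B a b) + (\<Sum>(a, b)\<leftarrow>\<Delta> y. B a b)" for x y
    using tensor2_eq_bilinear[OF comult_add B, of x y] by simp
  ultimately show ?thesis
    by (simp add: Vector_Spaces.linear_iff vector_space_axioms W.vector_space_axioms)
qed

lemma coassoc_trilinear:
  assumes "\<And>b c. Vector_Spaces.linear scale sW (\<lambda>a. T a b c)"
    and "\<And>a c. Vector_Spaces.linear scale sW (\<lambda>b. T a b c)"
    and "\<And>a b. Vector_Spaces.linear scale sW (\<lambda>c. T a b c)"
  shows "(\<Sum>(a, b)\<leftarrow>\<Delta> x. \<Sum>(a\<^sub>1, a\<^sub>2)\<leftarrow>\<Delta> a. T a\<^sub>1 a\<^sub>2 b) = (\<Sum>(a, b)\<leftarrow>\<Delta> x. \<Sum>(b\<^sub>1, b\<^sub>2)\<leftarrow>\<Delta> b. T a b\<^sub>1 b\<^sub>2)"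
proof -
  have l: "(\<Sum>(a, b, c)\<leftarrow>concat (map (\<lambda>(a, b). map (\<lambda>(a\<^sub>1, a\<^sub>2). (a\<^sub>1, a\<^sub>2, b)) (\<Delta> a)) zs). T a b c)
      = (\<Sum>(a, b)\<leftarrow>zs. \<Sum>(a\<^sub>1, a\<^sub>2)\<leftarrow>\<Delta> a. T a\<^sub>1 a\<^sub>2 b)" for zs
    by (induction zs) (auto simp: comp_def case_prod_unfold)
  have r: "(\<Sum>(a, b, c)\<leftarrow>concat (map (\<lambda>(a, b). map (\<lambda>(b\<^sub>1, b\<^sub>2). (a, b\<^sub>1, b\<^sub>2)) (\<Delta> b)) zs). T a b c)
      = (\<Sum>(a, b)\<leftarrow>zs. \<Sum>(b\<^sub>1, b\<^sub>2)\<leftarrow>\<Delta> b. T a b\<^sub>1 b\<^sub>2)" for zs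
    by (induction zs) (auto simp: comp_def case_prod_unfold)
  show ?thesis
    using tensor3_eq_trilinear[OF coassoc assms, of x] unfolding l r .
qed

abbreviation functional :: "('h \<Rightarrow> 'k) \<Rightarrow> bool" where
  "functional \<equiv> Vector_Spaces.linear scale (*)"

lemma functionalI:
  "(\<And>x y. \<phi> (x + y) = \<phi> x + \<phi> y) \<Longrightarrow> (\<And>c x. \<phi> (c *s x) = c * \<phi> x) \<Longrightarrow> functional \<phi>"
  by (simp add: Vector_Spaces.linear_iff vector_space_axioms vector_space_field)

lemma functionalD:
  assumes "functional \<phi>"
  shows "\<phi> (x + y) = \<phi> x + \<phi> y" "\<phi> (c *s x) = c * \<phi> x" "\<phi> 0 = 0" "\<phi> (x - y) = \<phi> x - \<phi> y"
proof -
  interpret Vector_Spaces.linear scale "(*)" \<phi> by fact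
  show "\<phi> (x + y) = \<phi> x + \<phi> y" "\<phi> (c *s x) = c * \<phi> x" "\<phi> 0 = 0" "\<phi> (x - y) = \<phi> x - \<phi> y"
    by (simp_all add: add scale zero diff)
qed

text \<open>The functionals, with product \<open>conv\<close> and unit \<open>\<epsilon>\<close>,
  form the dual algebra. It acts from the left by evaluating the second tensor factor
  (\<open>lact\<close>) and from the right by evaluating the first (\<open>ract\<close>).\<close>

definition lact :: "('h \<Rightarrow> 'k) \<Rightarrow> 'h \<Rightarrow> 'h" where
  "lact \<phi> x = (\<Sum>(a, b)\<leftarrow>\<Delta> x. \<phi> b *s a)"

definition ract :: "'h \<Rightarrow> ('h \<Rightarrow> 'k) \<Rightarrow> 'h" where
  "ract x \<phi> = (\<Sum>(a, b)\<leftarrow>\<Delta> x. \<phi> a *s b)"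

definition conv :: "('h \<Rightarrow> 'k) \<Rightarrow> ('h \<Rightarrow> 'k) \<Rightarrow> 'h \<Rightarrow> 'k" where
  "conv \<phi> \<psi> x = (\<Sum>(a, b)\<leftarrow>\<Delta> x. \<phi> a * \<psi> b)"

lemma bilinear_functional_scale:
  assumes "functional \<phi>"
  shows "bilinear_map scale scale (\<lambda>a b. \<phi> b *s a)" "bilinear_map scale scale (\<lambda>a b. \<phi> a *s b)"
  using assms
  by (auto intro!: bilinear_mapI simp: vector_space_axioms functionalD scale_right_distrib
      scale_left_distrib mult.commute)

lemma bilinear_functional_mult:
  assumes "functional \<phi>" "functional \<psi>"
  shows "bilinear_map scale (*) (\<lambda>a b. \<phi> a * \<psi> b)"
  using assms
  by (auto intro!: bilinear_mapI simp: vector_space_axioms vector_space_field functionalD algebra_simps)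

lemma linear_lact: "functional \<phi> \<Longrightarrow> Vector_Spaces.linear scale scale (lact \<phi>)"
  unfolding lact_def[abs_def] by (intro comult_linear bilinear_functional_scale)

lemma linear_ract: "functional \<phi> \<Longrightarrow> Vector_Spaces.linear scale scale (\<lambda>x. ract x \<phi>)"
  unfolding ract_def[abs_def] by (intro comult_linear bilinear_functional_scale)

lemma functional_conv: "functional \<phi> \<Longrightarrow> functional \<psi> \<Longrightarrow> functional (conv \<phi> \<psi>)"
  unfolding conv_def[abs_def] by (intro comult_linear bilinear_functional_mult)

lemma functional_counit: "functional \<epsilon>"
  by (rule counit_linear)

lemma functional_add: "functional \<phi> \<Longrightarrow> functional \<psi> \<Longrightarrow> functional (\<lambda>x. \<phi> x + \<psi> x)"
  by (auto intro!: functionalI simp: functionalD algebra_simps)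

lemma functional_diff: "functional \<phi> \<Longrightarrow> functional \<psi> \<Longrightarrow> functional (\<lambda>x. \<phi> x - \<psi> x)"
  by (auto intro!: functionalI simp: functionalD algebra_simps)

lemma functional_scale: "functional \<phi> \<Longrightarrow> functional (\<lambda>x. c * \<phi> x)"
  by (auto intro!: functionalI simp: functionalD algebra_simps)

lemma functional_zero: "functional (\<lambda>x. 0)"
  by (auto intro!: functionalI)

lemma lact_counit: "lact \<epsilon> x = x"
  unfolding lact_def by (rule counit_right)

lemma ract_counit: "ract x \<epsilon> = x"
  unfolding ract_def by (rule counit_left)

lemma lact_add: "functional \<phi> \<Longrightarrow> lact \<phi> (x + y) = lact \<phi> x + lact \<phi> y"
  and lact_scale: "functional \<phi> \<Longrightarrow> lact \<phi> (c *s x) = c *s lact \<phi> x"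
  using linear_lact by (auto simp: Vector_Spaces.linear_iff)

lemma lact_zero: "functional \<phi> \<Longrightarrow> lact \<phi> 0 = 0"
  using lact_scale[of \<phi> 0 0] by simp

lemma lact_functional_add: "lact (\<lambda>x. \<phi> x + \<psi> x) x = lact \<phi> x + lact \<psi> x"
  unfolding lact_def by (induction "\<Delta> x") (simp_all add: case_prod_unfold scale_left_distrib sum_list_addf)

lemma lact_functional_diff: "lact (\<lambda>x. \<phi> x - \<psi> x) x = lact \<phi> x - lact \<psi> x"
  unfolding lact_def by (simp add: case_prod_unfold scale_left_diff_distrib sum_list_subtractf)

lemma lact_functional_scale: "lact (\<lambda>x. c * \<phi> x) x = c *s lact \<phi> x"
  by (simp add: lact_def case_prod_unfold sum_list_linear[OF linear_scale_self])

text \<open>Together with separation of points by functionals, this reduces identities between the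
  actions to associativity of \<open>conv\<close>.\<close>

lemma functional_lact: "functional \<psi> \<Longrightarrow> \<psi> (lact \<phi> x) = conv \<psi> \<phi> x"
  unfolding lact_def conv_def
  by (simp add: sum_list_linear case_prod_unfold functionalD(2) mult.commute)

lemma functional_ract: "functional \<psi> \<Longrightarrow> \<psi> (ract x \<phi>) = conv \<phi> \<psi> x"
  unfolding ract_def conv_def
  by (simp add: sum_list_linear case_prod_unfold functionalD(2))

lemma functionals_separate: "x = y" if "\<And>\<phi>. functional \<phi> \<Longrightarrow> \<phi> x = \<phi> y"
proof (rule ccontr)
  assume "x \<noteq> y"
  then have "x - y \<notin> {0}" by simp
  then obtain \<phi> where "functional \<phi>" "\<phi> (x - y) = 1"
    by (rule separating_functional[OF subspace_single_0])
  with that[of \<phi>] show False by (simp add: functionalD)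
qed

lemma conv_assoc:
  assumes "functional \<phi>" "functional \<psi>" "functional \<chi>"
  shows "conv (conv \<phi> \<psi>) \<chi> x = conv \<phi> (conv \<psi> \<chi>) x"
proof -
  have "conv (conv \<phi> \<psi>) \<chi> x = (\<Sum>(a, b)\<leftarrow>\<Delta> x. \<Sum>(a\<^sub>1, a\<^sub>2)\<leftarrow>\<Delta> a. \<phi> a\<^sub>1 * \<psi> a\<^sub>2 * \<chi> b)"
    by (simp add: conv_def sum_list_mult_const case_prod_unfold)
  also have "\<dots> = (\<Sum>(a, b)\<leftarrow>\<Delta> x. \<Sum>(b\<^sub>1, b\<^sub>2)\<leftarrow>\<Delta> b. \<phi> a * \<psi> b\<^sub>1 * \<chi> b\<^sub>2)"
    using assms
    by (intro coassoc_trilinear[where sW = "(*)"] functionalI) (auto simp: functionalD algebra_simps)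
  also have "\<dots> = conv \<phi> (conv \<psi> \<chi>) x"
    by (simp add: conv_def sum_list_const_mult case_prod_unfold mult.assoc)
  finally show ?thesis .
qed

lemma lact_lact:
  assumes "functional \<phi>" "functional \<psi>"
  shows "lact \<phi> (lact \<psi> x) = lact (conv \<phi> \<psi>) x"
  using assms by (intro functionals_separate) (simp add: functional_lact functional_conv conv_assoc)

text \<open>The actions evaluate opposite outer tensor factors, so they commute by
  coassociativity.\<close>

lemma lact_ract:
  assumes "functional \<phi>" "functional \<psi>"
  shows "lact \<phi> (ract x \<psi>) = ract (lact \<phi> x) \<psi>"
  using assms
  by (intro functionals_separate)
    (simp add: functional_lact functional_ract functional_conv conv_assoc)

lemma tensor2_eq_comult_iff:
  "tensor2_eq scale (\<Delta> x) xs \<longleftrightarrow>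
    (\<forall>\<phi> \<psi>. functional \<phi> \<longrightarrow> functional \<psi> \<longrightarrow> conv \<phi> \<psi> x = (\<Sum>(a, b)\<leftarrow>xs. \<phi> a * \<psi> b))"
  using tensor2_eqI[OF vector_space_axioms, of "\<Delta> x" xs]
    tensor2_eq_bilinear[of scale "\<Delta> x" xs "(*)"] bilinear_functional_mult
  unfolding conv_def by blast

text \<open>Local finiteness: all left translates of \<open>x\<close> lie in one finite-dimensional
  space, independent of \<open>\<phi>\<close>.\<close>

lemma lact_in_span: "lact \<phi> x \<in> span (fst ` set (\<Delta> x))"
proof -
  have "(\<Sum>(a, b)\<leftarrow>zs. \<phi> b *s a) \<in> span (fst ` set zs)" for zs
  proof (induction zs)
    case (Cons z zs)
    have "span (fst ` set zs) \<subseteq> span (fst ` set (z # zs))" by (intro span_mono) auto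
    with Cons show ?case
      by (cases z) (auto intro!: span_add span_scale intro: span_base)
  qed (simp add: span_zero)
  then show ?thesis by (simp add: lact_def)
qed

text \<open>Sub-bimodules are subcoalgebras. The left translates of \<open>x\<close> have a finite
  basis \<open>E\<close>; expanding the first tensor factor in \<open>E\<close> puts right
  translates of \<open>x\<close> into the second.\<close>

lemma subcoalgebraI:
  assumes C: "subspace C"
    and lact: "\<And>\<phi> x. functional \<phi> \<Longrightarrow> x \<in> C \<Longrightarrow> lact \<phi> x \<in> C"
    and ract: "\<And>\<phi> x. functional \<phi> \<Longrightarrow> x \<in> C \<Longrightarrow> ract x \<phi> \<in> C"
  shows "subcoalgebra C"
  unfolding subcoalgebra_def
proof (intro conjI C ballI)
  fix x assume x: "x \<in> C"
  let ?L = "{lact \<phi> x | \<phi>. functional \<phi>}"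
  obtain E where E: "E \<subseteq> ?L" "independent E" "?L \<subseteq> span E"
    by (rule basis_exists)
  have "?L \<subseteq> span (fst ` set (\<Delta> x))" using lact_in_span by auto
  then have "finite E"
    using independent_span_bound[OF _ E(2), of "fst ` set (\<Delta> x)"] E(1) by auto
  obtain \<phi> where \<phi>: "\<And>e. functional (\<phi> e)" "\<And>v. v \<in> span E \<Longrightarrow> v = (\<Sum>e\<in>E. \<phi> e v *s e)"
    by (rule dual_basis[OF \<open>finite E\<close> E(2)]) (rule that)
  obtain es where es: "set es = E" "distinct es"
    using finite_distinct_list[OF \<open>finite E\<close>] by auto
  \<comment> \<open>The first entries are left translates of \<open>x\<close>, the second ones right
    translates, so both lie in \<open>C\<close>.\<close>
  let ?xs = "map (\<lambda>e. (e, ract x (\<phi> e))) es"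
  have "tensor2_eq scale (\<Delta> x) ?xs"
    unfolding tensor2_eq_comult_iff
  proof (intro allI impI)
    fix \<chi> \<psi> assume \<chi>: "functional \<chi>" and \<psi>: "functional \<psi>"
    interpret \<chi>: Vector_Spaces.linear scale "(*)" \<chi> by fact
    have "lact \<psi> x = (\<Sum>e\<in>E. \<phi> e (lact \<psi> x) *s e)"
      using E(3) \<psi> by (intro \<phi>(2)) auto
    then have "\<chi> (lact \<psi> x) = \<chi> (\<Sum>e\<in>E. \<phi> e (lact \<psi> x) *s e)"
      by (rule arg_cong)
    also have "\<dots> = (\<Sum>e\<in>E. \<psi> (ract x (\<phi> e)) * \<chi> e)"
      using \<phi>(1) \<psi> by (simp add: \<chi>.sum \<chi>.scale functional_lact functional_ract)
    also have "\<dots> = (\<Sum>(a, b)\<leftarrow>?xs. \<chi> a * \<psi> b)"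
      using es by (simp add: sum_list_distinct_conv_sum_set comp_def mult.commute)
    finally show "conv \<chi> \<psi> x = (\<Sum>(a, b)\<leftarrow>?xs. \<chi> a * \<psi> b)"
      using \<chi> by (simp add: functional_lact)
  qed
  moreover have "set ?xs \<subseteq> C \<times> C"
    using E(1) es(1) x \<phi>(1) by (auto intro: lact ract)
  ultimately show "\<exists>xs. set xs \<subseteq> C \<times> C \<and> tensor2_eq scale (\<Delta> x) xs" by blast
qed

text \<open>The action may be computed from any representative of the tensor, in particular from one
  with all entries in \<open>D\<close>.\<close>

lemma subcoalgebra_lact_eq_0:
  assumes "subcoalgebra D" "x \<in> D" "functional \<phi>" "\<And>y. y \<in> D \<Longrightarrow> \<phi> y = 0"
  shows "lact \<phi> x = 0"
proof -
  obtain xs where xs: "set xs \<subseteq> D \<times> D" "tensor2_eq scale (\<Delta> x) xs"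
    using assms unfolding subcoalgebra_def by blast
  have "lact \<phi> x = (\<Sum>(a, b)\<leftarrow>xs. \<phi> b *s a)"
    unfolding lact_def
    by (rule tensor2_eq_bilinear[OF xs(2)]) (rule bilinear_functional_scale[OF assms(3)])
  also have "\<dots> = (\<Sum>p\<leftarrow>xs. 0)"
    using xs(1) assms(4) by (intro arg_cong[of _ _ sum_list] map_cong) auto
  finally show ?thesis by simp
qed

lemma subcoalgebra_lact_closed:
  assumes "subcoalgebra D" "x \<in> D" "functional \<phi>"
  shows "lact \<phi> x \<in> D"
proof -
  obtain xs where xs: "set xs \<subseteq> D \<times> D" "tensor2_eq scale (\<Delta> x) xs" and D: "subspace D"
    using assms unfolding subcoalgebra_def by blast
  have "lact \<phi> x = (\<Sum>(a, b)\<leftarrow>xs. \<phi> b *s a)"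
    unfolding lact_def
    by (rule tensor2_eq_bilinear[OF xs(2)]) (rule bilinear_functional_scale[OF assms(3)])
  also have "\<dots> \<in> D"
    using xs(1) by (induction xs) (auto intro: subspace_add[OF D] subspace_scale[OF D] subspace_0[OF D])
  finally show ?thesis .
qed

lemma subcoalgebra_ract_closed:
  assumes "subcoalgebra D" "x \<in> D" "functional \<phi>"
  shows "ract x \<phi> \<in> D"
proof -
  obtain xs where xs: "set xs \<subseteq> D \<times> D" "tensor2_eq scale (\<Delta> x) xs" and D: "subspace D"
    using assms unfolding subcoalgebra_def by blast
  have "ract x \<phi> = (\<Sum>(a, b)\<leftarrow>xs. \<phi> a *s b)"
    unfolding ract_def
    by (rule tensor2_eq_bilinear[OF xs(2)]) (rule bilinear_functional_scale[OF assms(3)])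
  also have "\<dots> \<in> D"
    using xs(1) by (induction xs) (auto intro: subspace_add[OF D] subspace_scale[OF D] subspace_0[OF D])
  finally show ?thesis .
qed

section \<open>Right coideals as modules over the dual algebra, and the coradical\<close>

definition left_submodule :: "'h set \<Rightarrow> bool" where
  "left_submodule M \<longleftrightarrow> subspace M \<and> (\<forall>\<phi> x. functional \<phi> \<longrightarrow> x \<in> M \<longrightarrow> lact \<phi> x \<in> M)"

lemma left_submoduleD:
  assumes "left_submodule M"
  shows "subspace M" "functional \<phi> \<Longrightarrow> x \<in> M \<Longrightarrow> lact \<phi> x \<in> M"
    "0 \<in> M" "x \<in> M \<Longrightarrow> y \<in> M \<Longrightarrow> x + y \<in> M" "x \<in> M \<Longrightarrow> y \<in> M \<Longrightarrow> x - y \<in> M"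
    "x \<in> M \<Longrightarrow> c *s x \<in> M"
  using assms by (auto simp: left_submodule_def subspace_0 subspace_add subspace_diff subspace_scale)

definition left_ideal :: "('h \<Rightarrow> 'k) set \<Rightarrow> bool" where
  "left_ideal X \<longleftrightarrow> (\<forall>\<kappa>\<in>X. functional \<kappa>) \<and> (\<lambda>x. 0) \<in> X \<and>
     (\<forall>\<kappa>\<in>X. \<forall>\<mu>\<in>X. (\<lambda>x. \<kappa> x + \<mu> x) \<in> X) \<and> (\<forall>c. \<forall>\<kappa>\<in>X. (\<lambda>x. c * \<kappa> x) \<in> X) \<and>
     (\<forall>\<psi>. functional \<psi> \<longrightarrow> (\<forall>\<kappa>\<in>X. conv \<psi> \<kappa> \<in> X))"

text \<open>This is \<open>X m + N'\<close>, the submodule to which simplicity of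
  \<open>N/N'\<close> gets applied; the ideal property gives stability through
  \<open>lact_lact\<close>.\<close>

lemma left_submodule_orbit:
  assumes "left_ideal X" "left_submodule N'"
  shows "left_submodule {lact \<kappa> m + y | \<kappa> y. \<kappa> \<in> X \<and> y \<in> N'}" (is "left_submodule ?M")
  unfolding left_submodule_def
proof (intro conjI allI impI)
  note N' = left_submoduleD[OF assms(2)]
  have X: "functional \<kappa>" "(\<lambda>x. \<kappa> x + \<mu> x) \<in> X" "(\<lambda>x. c * \<kappa> x) \<in> X" "functional \<psi> \<Longrightarrow> conv \<psi> \<kappa> \<in> X"
    if "\<kappa> \<in> X" "\<mu> \<in> X" for \<kappa> \<mu> c \<psi>
    using that assms(1) by (auto simp: left_ideal_def)
  have zero: "(\<lambda>x. 0) \<in> X" using assms(1) by (simp add: left_ideal_def)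
  show "subspace ?M"
  proof (rule subspaceI)
    have "lact (\<lambda>x. 0) m = 0" by (simp add: lact_def case_prod_unfold)
    then show "0 \<in> ?M" using zero N'(3) by force
  next
    fix x y assume "x \<in> ?M" "y \<in> ?M"
    then obtain \<kappa> u \<mu> v where *: "x = lact \<kappa> m + u" "y = lact \<mu> m + v" "\<kappa> \<in> X" "\<mu> \<in> X" "u \<in> N'" "v \<in> N'"
      by blast
    then have "x + y = lact (\<lambda>x. \<kappa> x + \<mu> x) m + (u + v)"
      by (simp add: lact_functional_add algebra_simps)
    with * X(2) N'(4) show "x + y \<in> ?M" by blast
  next
    fix c x assume "x \<in> ?M"
    then obtain \<kappa> u where *: "x = lact \<kappa> m + u" "\<kappa> \<in> X" "u \<in> N'"
      by blast
    then have "c *s x = lact (\<lambda>x. c * \<kappa> x) m + c *s u"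
      by (simp add: lact_functional_scale scale_right_distrib)
    with * X(3) N'(6) show "c *s x \<in> ?M" by blast
  qed
next
  note N' = left_submoduleD[OF assms(2)]
  fix \<phi> x assume \<phi>: "functional \<phi>" and "x \<in> ?M"
  then obtain \<kappa> u where *: "x = lact \<kappa> m + u" "\<kappa> \<in> X" "u \<in> N'"
    by blast
  have "functional \<kappa>" "conv \<phi> \<kappa> \<in> X" using assms(1) * \<phi> by (auto simp: left_ideal_def)
  then have "lact \<phi> x = lact (conv \<phi> \<kappa>) m + lact \<phi> u"
    using \<phi> * by (simp add: lact_add lact_lact)
  with \<open>conv \<phi> \<kappa> \<in> X\<close> N'(2)[OF \<phi> *(3)] show "lact \<phi> x \<in> ?M" by blast
qed

text \<open>
  Density argument on the simple module \<open>N/N'\<close>; applied to finite-dimensional \<open>N\<close> it shows that the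
  image of the dual algebra in the endomorphisms of \<open>N/N'\<close> is a simple algebra.
\<close>

lemma ideal_density:
  assumes N': "left_submodule N'" and N: "left_submodule N"
    and simple: "\<And>M. left_submodule M \<Longrightarrow> N' \<subseteq> M \<Longrightarrow> M \<subseteq> N \<Longrightarrow> M = N' \<or> M = N"
    and NN: "N' \<subseteq> N"
    and I: "left_ideal I" "\<And>\<iota> \<psi>. \<iota> \<in> I \<Longrightarrow> functional \<psi> \<Longrightarrow> conv \<iota> \<psi> \<in> I"
    and act: "\<iota>\<^sub>0 \<in> I" "n\<^sub>0 \<in> N" "lact \<iota>\<^sub>0 n\<^sub>0 \<notin> N'"
    and F: "finite F" "F \<subseteq> N" and \<phi>: "functional \<phi>"
  shows "\<exists>\<iota>\<in>I. \<forall>n\<in>F. lact (\<lambda>x. \<phi> x - \<iota> x) n \<in> N'"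
  using F \<phi>
proof (induction F arbitrary: \<phi> rule: finite_induct)
  case empty
  show ?case using act(1) by auto
next
  case (insert m F)
  note sub' = left_submoduleD[OF N'] and sub = left_submoduleD[OF N]
  have Ifun: "functional \<iota>" if "\<iota> \<in> I" for \<iota>
    using I(1) that by (simp add: left_ideal_def)
  \<comment> \<open>The annihilator of \<open>F\<close> modulo \<open>N'\<close>: elements of
    \<open>K\<close> can correct the action on \<open>m\<close> without disturbing
    \<open>F\<close>.\<close>
  define K where "K = {\<kappa>. functional \<kappa> \<and> (\<forall>n\<in>F. lact \<kappa> n \<in> N')}"
  have K: "left_ideal K"
    unfolding left_ideal_def K_def
    by (auto simp: functional_zero functional_add functional_scale functional_conv
        lact_functional_add lact_functional_scale lact_lact[symmetric] sub')
      (simp add: lact_def case_prod_unfold sub'(3))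
  have KI: "left_ideal (K \<inter> I)"
    using K I(1) unfolding left_ideal_def by blast
  have IK: "conv \<iota> \<kappa> \<in> K \<inter> I" if "\<iota> \<in> I" "\<kappa> \<in> K" for \<iota> \<kappa>
    using that K I(2) Ifun by (auto simp: left_ideal_def)
  obtain \<iota> where \<iota>: "\<iota> \<in> I" "\<forall>n\<in>F. lact (\<lambda>x. \<phi> x - \<iota> x) n \<in> N'"
    using insert.IH[OF _ insert.prems(2)] insert.prems(1) by blast
  then have \<phi>\<iota>: "(\<lambda>x. \<phi> x - \<iota> x) \<in> K"
    using Ifun insert.prems(2) by (simp add: K_def functional_diff)
  have mN: "m \<in> N" using insert.prems(1) by simp
  have orbit: "N' \<subseteq> {lact \<kappa> m + y | \<kappa> y. \<kappa> \<in> X \<and> y \<in> N'}" "{lact \<kappa> m + y | \<kappa> y. \<kappa> \<in> X \<and> y \<in> N'} \<subseteq> N"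
    if "left_ideal X" for X
  proof
    fix y assume "y \<in> N'"
    moreover have "y = lact (\<lambda>x. 0) m + y" by (simp add: lact_def case_prod_unfold)
    ultimately show "y \<in> {lact \<kappa> m + y | \<kappa> y. \<kappa> \<in> X \<and> y \<in> N'}"
      using that unfolding left_ideal_def by blast
  next
    show "{lact \<kappa> m + y | \<kappa> y. \<kappa> \<in> X \<and> y \<in> N'} \<subseteq> N"
      using that NN mN by (auto simp: left_ideal_def intro!: sub(4) sub(2))
  qed
  show ?case
  proof (cases "lact (\<lambda>x. \<phi> x - \<iota> x) m \<in> N'")
    case True
    with \<iota> show ?thesis by blast
  next
    case False
    let ?M1 = "{lact \<kappa> m + y | \<kappa> y. \<kappa> \<in> K \<and> y \<in> N'}"
    let ?M2 = "{lact \<kappa> m + y | \<kappa> y. \<kappa> \<in> K \<inter> I \<and> y \<in> N'}"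
    have "lact (\<lambda>x. \<phi> x - \<iota> x) m + 0 \<in> ?M1"
      using \<phi>\<iota> sub'(3) by blast
    moreover have "lact (\<lambda>x. \<phi> x - \<iota> x) m + 0 \<notin> N'"
      using False by simp
    \<comment> \<open>\<open>K m\<close> is not contained in \<open>N'\<close>, so by simplicity it
      fills \<open>N\<close> modulo \<open>N'\<close>.\<close>
    ultimately have M1: "?M1 = N"
      using simple[OF left_submodule_orbit[OF K N'] orbit[OF K]] by blast
    \<comment> \<open>The same holds for \<open>K \<inter> I\<close>: since \<open>I K\<close> lies
      in \<open>K \<inter> I\<close> and \<open>K m\<close> fills \<open>N\<close> modulo
      \<open>N'\<close>, otherwise \<open>I\<close> would map all of \<open>N\<close> into
      \<open>N'\<close>, against the choice of \<open>n\<^sub>0\<close>.\<close>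
    have M2: "?M2 = N"
    proof (rule ccontr)
      assume "?M2 \<noteq> N"
      then have M2: "?M2 = N'"
        using simple[OF left_submodule_orbit[OF KI N'] orbit[OF KI]] by blast
      obtain \<kappa> y where \<kappa>: "n\<^sub>0 = lact \<kappa> m + y" "\<kappa> \<in> K" "y \<in> N'"
        using act(2) M1 by blast
      have lin: "functional \<kappa>" "functional \<iota>\<^sub>0"
        using \<kappa>(2) K act(1) Ifun by (auto simp: left_ideal_def)
      have "lact (conv \<iota>\<^sub>0 \<kappa>) m + 0 \<in> ?M2"
        using IK[OF act(1) \<kappa>(2)] sub'(3) by blast
      then have "lact (conv \<iota>\<^sub>0 \<kappa>) m \<in> N'" unfolding M2 by simp
      moreover have "lact \<iota>\<^sub>0 n\<^sub>0 = lact (conv \<iota>\<^sub>0 \<kappa>) m + lact \<iota>\<^sub>0 y"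
        using \<kappa>(1) lin by (simp add: lact_add lact_lact)
      ultimately show False
        using act(3) sub'(4) sub'(2)[OF lin(2) \<kappa>(3)] by simp
    qed
    have "lact (\<lambda>x. \<phi> x - \<iota> x) m \<in> N"
      using \<phi>\<iota> K mN by (intro sub(2)) (auto simp: left_ideal_def)
    \<comment> \<open>The error left on \<open>m\<close> is cancelled by some
      \<open>\<kappa>\<close> in \<open>K \<inter> I\<close>; the corrected functional is
      \<open>\<iota> + \<kappa>\<close>.\<close>
    then obtain \<kappa> y where \<kappa>: "lact (\<lambda>x. \<phi> x - \<iota> x) m = lact \<kappa> m + y" "\<kappa> \<in> K" "\<kappa> \<in> I" "y \<in> N'"
      using M2 by blast
    have split_diff: "lact (\<lambda>x. \<phi> x - (\<iota> x + \<kappa> x)) n = lact (\<lambda>x. \<phi> x - \<iota> x) n - lact \<kappa> n" for n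
      by (simp add: lact_functional_diff lact_functional_add)
    have "lact (\<lambda>x. \<phi> x - (\<iota> x + \<kappa> x)) n \<in> N'" if "n \<in> insert m F" for n
      using that \<iota>(2) \<kappa> sub'(5) unfolding split_diff by (auto simp: K_def)
    moreover have "(\<lambda>x. \<iota> x + \<kappa> x) \<in> I"
      using I(1) \<iota>(1) \<kappa>(3) by (simp add: left_ideal_def)
    ultimately show ?thesis by (intro bexI[of _ "\<lambda>x. \<iota> x + \<kappa> x"] ballI)
  qed
qed

text \<open>
  The functionals mapping \<open>N\<close> into \<open>N'\<close> form a maximal ideal of finite codimension, whose annihilator
  in the coalgebra is a simple subcoalgebra.
\<close>

lemma simple_subquotient_coradical:
  assumes N': "left_submodule N'" and N: "left_submodule N"
    and simple: "\<And>M. left_submodule M \<Longrightarrow> N' \<subseteq> M \<Longrightarrow> M \<subseteq> N \<Longrightarrow> M = N' \<or> M = N"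
    and NN: "N' \<subset> N" and F: "finite F" "N \<subseteq> span F"
    and \<phi>: "functional \<phi>" "\<And>x. x \<in> coradical \<Longrightarrow> \<phi> x = 0" and n: "n \<in> N"
  shows "lact \<phi> n \<in> N'"
proof -
  note sub' = left_submoduleD[OF N'] and sub = left_submoduleD[OF N]
  define C where "C = {x. \<forall>\<phi>. functional \<phi> \<longrightarrow> (\<forall>n\<in>N. lact \<phi> n \<in> N') \<longrightarrow> \<phi> x = 0}"
  \<comment> \<open>Double annihilator property: \<open>C\<close> contains all matrix coefficients
    of \<open>N/N'\<close>, so a functional vanishing on \<open>C\<close> acts as zero
    there.\<close>
  have ann: "lact \<phi> n \<in> N'" if \<phi>: "functional \<phi>" "\<And>x. x \<in> C \<Longrightarrow> \<phi> x = 0" and n: "n \<in> N" for \<phi> n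
  proof (rule ccontr)
    assume "lact \<phi> n \<notin> N'"
    then obtain \<xi> where \<xi>: "functional \<xi>" "\<And>y. y \<in> N' \<Longrightarrow> \<xi> y = 0" "\<xi> (lact \<phi> n) = 1"
      by (rule separating_functional[OF sub'(1)]) (rule that)
    have "ract n \<xi> \<in> C"
      using n \<xi>(1,2) by (auto simp: C_def functional_ract functional_lact[symmetric])
    with \<phi> have "\<phi> (ract n \<xi>) = 0" by simp
    with \<xi> \<phi>(1) show False by (simp add: functional_ract functional_lact)
  qed
  have C: "subcoalgebra C"
  proof (rule subcoalgebraI)
    show "subspace C" by (auto intro!: subspaceI simp: C_def functionalD)
    fix \<psi> x assume \<psi>: "functional \<psi>" and x: "x \<in> C"
    show "lact \<psi> x \<in> C"
      using x \<psi> sub(2)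
      by (auto simp: C_def functional_lact functional_conv lact_lact[symmetric])
    show "ract x \<psi> \<in> C"
      using x \<psi> sub'(2)
      by (auto simp: C_def functional_ract functional_conv lact_lact[symmetric])
  qed
  \<comment> \<open>Otherwise \<open>\<epsilon>\<close> would vanish on \<open>C\<close>, yet it
    acts as the identity and \<open>N\<close> is larger than \<open>N'\<close>.\<close>
  have "C \<noteq> {0}"
  proof
    assume "C = {0}"
    then have "m \<in> N'" if "m \<in> N" for m
      using ann[OF functional_counit _ that] functionalD(3)[OF functional_counit]
      by (simp add: lact_counit)
    with NN show False by blast
  qed
  moreover have "D = {0} \<or> D = C" if D: "subcoalgebra D" "D \<subseteq> C" for D
  proof (rule ccontr)
    assume "\<not> (D = {0} \<or> D = C)"
    then have "D \<noteq> {0}" "D \<noteq> C" by auto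
    have sD: "subspace D" using D(1) by (simp add: subcoalgebra_def)
    define I where "I = {\<iota>. functional \<iota> \<and> (\<forall>x\<in>D. \<iota> x = 0)}"
    \<comment> \<open>The annihilator of a subcoalgebra is a two-sided ideal of the dual
      algebra.\<close>
    have I: "left_ideal I" "\<And>\<iota> \<psi>. \<iota> \<in> I \<Longrightarrow> functional \<psi> \<Longrightarrow> conv \<iota> \<psi> \<in> I"
      using subcoalgebra_lact_closed[OF D(1)] subcoalgebra_ract_closed[OF D(1)]
      by (auto simp: left_ideal_def I_def functional_zero functional_add functional_scale
          functional_conv functional_lact[symmetric])
        (simp add: functional_lact functional_ract[symmetric])
    obtain x where "x \<in> C" "x \<notin> D" using \<open>D \<noteq> C\<close> D(2) by blast
    obtain \<iota>\<^sub>0 where \<iota>\<^sub>0: "functional \<iota>\<^sub>0" "\<And>y. y \<in> D \<Longrightarrow> \<iota>\<^sub>0 y = 0" "\<iota>\<^sub>0 x = 1"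
      using \<open>x \<notin> D\<close> by (rule separating_functional[OF sD]) (rule that)
    then have "\<iota>\<^sub>0 \<in> I" by (simp add: I_def)
    have "\<not> (\<forall>n\<in>N. lact \<iota>\<^sub>0 n \<in> N')"
    proof
      assume "\<forall>n\<in>N. lact \<iota>\<^sub>0 n \<in> N'"
      with \<open>x \<in> C\<close> \<iota>\<^sub>0(1) have "\<iota>\<^sub>0 x = 0" unfolding C_def by simp
      with \<iota>\<^sub>0(3) show False by simp
    qed
    then obtain n\<^sub>0 where n\<^sub>0: "n\<^sub>0 \<in> N" "lact \<iota>\<^sub>0 n\<^sub>0 \<notin> N'" by blast
    obtain E where E: "E \<subseteq> N" "independent E" "N \<subseteq> span E"
      by (rule basis_exists)
    then have "finite E" using independent_span_bound[OF F(1) E(2)] F(2) by blast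
    \<comment> \<open>As \<open>D\<close> is properly smaller than \<open>C\<close>, the ideal
      \<open>I\<close> acts nontrivially on \<open>N/N'\<close>. By density on a finite basis, some
      \<open>\<iota>\<close> in \<open>I\<close> acts there as the identity.\<close>
    obtain \<iota> where \<iota>: "\<iota> \<in> I" "\<And>m. m \<in> E \<Longrightarrow> lact (\<lambda>x. \<epsilon> x - \<iota> x) m \<in> N'"
      using ideal_density[OF N' N simple psubset_imp_subset[OF NN] I \<open>\<iota>\<^sub>0 \<in> I\<close> n\<^sub>0 \<open>finite E\<close> E(1) functional_counit]
      by blast
    have lin: "functional (\<lambda>x. \<epsilon> x - \<iota> x)"
      using \<iota>(1) by (simp add: I_def functional_diff functional_counit)
    have "subspace {m. lact (\<lambda>x. \<epsilon> x - \<iota> x) m \<in> N'}"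
      by (intro subspaceI) (auto simp: lact_zero lact_add lact_scale lin sub')
    then have "span E \<subseteq> {m. lact (\<lambda>x. \<epsilon> x - \<iota> x) m \<in> N'}"
      using \<iota>(2) by (intro span_minimal) auto
    \<comment> \<open>On \<open>D\<close> the functional \<open>\<iota>\<close> is zero and agrees
      with \<open>\<epsilon>\<close>; hence \<open>\<epsilon>\<close> vanishes on \<open>D\<close>
      and the counit axiom forces \<open>D = {0}\<close>.\<close>
    then have vanish: "\<epsilon> x - \<iota> x = 0" if "x \<in> D" for x
      using that D(2) E(3) lin unfolding C_def by blast
    have "x = 0" if "x \<in> D" for x
      using subcoalgebra_lact_eq_0[OF D(1) that functional_counit] vanish \<iota>(1)
      by (auto simp: lact_counit I_def)
    with \<open>D \<noteq> {0}\<close> subspace_0[OF sD] show False by blast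
  qed
  ultimately have "simple_subcoalgebra C"
    using C by (simp add: simple_subcoalgebra_def)
  then have "C \<subseteq> coradical"
    unfolding coradical_def by (auto intro: span_base)
  with \<phi> n show ?thesis by (intro ann) auto
qed

end

section \<open>Unitriangular coefficients in a connected Hopf algebra\<close>

lemma (in vector_space) dim_psubset_span:
  assumes "subspace M" "M \<subset> N" "finite F" "N \<subseteq> span F"
  shows "dim M < dim N"
proof -
  obtain B where B: "B \<subseteq> M" "independent B" "M \<subseteq> span B" "card B = dim M"
    by (rule basis_exists)
  obtain E where E: "E \<subseteq> N" "independent E" "N \<subseteq> span E" "card E = dim N"
    by (rule basis_exists)
  have finE: "finite E" using independent_span_bound[OF assms(3) E(2)] E(1) assms(4) by blast
  obtain e where e: "e \<in> N" "e \<notin> M" using assms(2) by blast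
  then have "e \<notin> span B" using span_minimal[OF B(1) assms(1)] by blast
  then have indep: "independent (insert e B)" "e \<notin> B"
    using independent_insertI[OF _ B(2)] span_base by auto
  have "insert e B \<subseteq> span E" using B(1) e(1) E(3) assms(2) by blast
  from independent_span_bound[OF finE indep(1) this] indep(2) show ?thesis
    using B(4) E(4) by auto
qed

context connected_hopf_algebra
begin

text \<open>The initial segments span a full flag of submodules, each of whose one-dimensional
  quotients carries the trivial action by \<open>\<phi> 1\<close>.\<close>

definition triangular :: "'b list \<Rightarrow> bool" where
  "triangular es \<longleftrightarrow> distinct es \<and> independent (set es) \<and>
     (\<forall>i<length es. \<forall>\<phi>. functional \<phi> \<longrightarrow> lact \<phi> (es ! i) - \<phi> 1 *s es ! i \<in> span (set (take i es)))"

lemma triangular_lact: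
  assumes "triangular es" "e \<in> set es" "functional \<phi>"
  shows "lact \<phi> e \<in> span (set es)"
proof -
  obtain i where i: "i < length es" "e = es ! i" using assms(2) by (auto simp: in_set_conv_nth)
  have "lact \<phi> e - \<phi> 1 *s e \<in> span (set (take i es))"
    using assms(1,3) i by (simp add: triangular_def)
  moreover have "span (set (take i es)) \<subseteq> span (set es)"
    by (intro span_mono set_take_subset)
  ultimately have "(lact \<phi> e - \<phi> 1 *s e) + \<phi> 1 *s e \<in> span (set es)"
    using assms(2) by (intro span_add span_scale) (auto intro: span_base)
  then show ?thesis by simp
qed

lemma triangular_left_submodule:
  assumes "triangular es"
  shows "left_submodule (span (set es))"
  unfolding left_submodule_def
proof (intro conjI allI impI)
  fix \<phi> x assume \<phi>: "functional \<phi>" and "x \<in> span (set es)"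
  have "subspace {x. lact \<phi> x \<in> span (set es)}"
    using \<phi> by (intro subspaceI) (auto simp: lact_zero lact_add lact_scale span_zero span_add span_scale)
  then have "span (set es) \<subseteq> {x. lact \<phi> x \<in> span (set es)}"
    using triangular_lact[OF assms _ \<phi>] by (intro span_minimal) auto
  with \<open>x \<in> span (set es)\<close> show "lact \<phi> x \<in> span (set es)" by blast
qed simp

lemma triangular_snoc:
  assumes "triangular es" "e \<notin> span (set es)"
    and "\<And>\<phi>. functional \<phi> \<Longrightarrow> lact \<phi> e - \<phi> 1 *s e \<in> span (set es)"
  shows "triangular (es @ [e])"
  using assms span_base[of e "set es"]
  by (auto simp: triangular_def nth_append less_Suc_eq independent_insertI)

text \<open>Take a longest triangular list in the orbit of \<open>x\<close>. If its span missed
  \<open>x\<close>, a minimal submodule of the orbit above it would give a simple quotient, on which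
  connectedness makes the action trivial, and the list could be prolonged.\<close>

lemma ex_triangular: "\<exists>es. triangular es \<and> x \<in> span (set es)"
proof -
  define M where "M = {lact \<phi> x | \<phi>. functional \<phi>}"
  let ?F = "fst ` set (\<Delta> x)"
  have M: "left_submodule M"
  proof -
    have "left_ideal (Collect functional)"
      by (simp add: left_ideal_def functional_zero functional_add functional_scale functional_conv)
    moreover have "left_submodule {0}"
      by (simp add: left_submodule_def lact_zero)
    ultimately have "left_submodule {lact \<phi> x + y | \<phi> y. \<phi> \<in> Collect functional \<and> y \<in> {0}}"
      by (rule left_submodule_orbit)
    moreover have "{lact \<phi> x + y | \<phi> y. \<phi> \<in> Collect functional \<and> y \<in> {0}} = M"
      by (auto simp: M_def)
    ultimately show ?thesis by (simp only:)
  qed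
  have MF: "M \<subseteq> span ?F" using lact_in_span by (auto simp: M_def)
  have xM: "x \<in> M"
    unfolding M_def using functional_counit lact_counit by (metis (mono_tags) mem_Collect_eq)
  define P where "P es \<longleftrightarrow> triangular es \<and> set es \<subseteq> M" for es
  have "P []" by (simp add: P_def triangular_def independent_empty)
  \<comment> \<open>Independence inside the finite-dimensional orbit bounds the length, so a longest
    list exists.\<close>
  moreover have "\<forall>es. P es \<longrightarrow> length es < Suc (card ?F)"
  proof (intro allI impI)
    fix es assume "P es"
    then have "card (set es) \<le> card ?F" "distinct es"
      using independent_span_bound[of ?F "set es"] MF by (auto simp: P_def triangular_def)
    then show "length es < Suc (card ?F)" by (simp add: distinct_card)
  qed
  ultimately obtain es where es: "P es" "\<And>es'. P es' \<Longrightarrow> length es' \<le> length es"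
    using ex_has_greatest_nat[of P "[]" length] by blast
  let ?N' = "span (set es)"
  have N': "left_submodule ?N'" using es(1) triangular_left_submodule by (simp add: P_def)
  have N'M: "?N' \<subseteq> M"
    using es(1) left_submoduleD(1)[OF M] by (intro span_minimal) (auto simp: P_def)
  have "x \<in> ?N'"
  proof (rule ccontr)
    assume "x \<notin> ?N'"
    define Q where "Q N \<longleftrightarrow> left_submodule N \<and> ?N' \<subset> N \<and> N \<subseteq> M" for N
    have "Q M" using M N'M xM \<open>x \<notin> ?N'\<close> by (auto simp: Q_def)
    \<comment> \<open>Least dimension among the submodules strictly above the span makes the
      quotient simple.\<close>
    then obtain N where N: "Q N" "\<And>N1. Q N1 \<Longrightarrow> dim N \<le> dim N1"
      using ex_has_least_nat[of Q M dim] by blast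
    have NF: "N \<subseteq> span ?F" using N(1) MF by (auto simp: Q_def)
    have simple: "M1 = ?N' \<or> M1 = N" if M1: "left_submodule M1" "?N' \<subseteq> M1" "M1 \<subseteq> N" for M1
    proof (rule ccontr)
      assume "\<not> ?thesis"
      then have "Q M1" "M1 \<subset> N" using M1 N(1) by (auto simp: Q_def)
      with dim_psubset_span[OF left_submoduleD(1)[OF M1(1)] _ _ NF] N(2)[of M1] show False by simp
    qed
    obtain e where e: "e \<in> N" "e \<notin> ?N'" using N(1) by (auto simp: Q_def)
    have "lact \<phi> e - \<phi> 1 *s e \<in> ?N'" if \<phi>: "functional \<phi>" for \<phi>
    proof -
      \<comment> \<open>This functional vanishes at 1, hence on the coradical, so it maps
        \<open>N\<close> into \<open>?N'\<close>; that is exactly triangularity for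
        \<open>e\<close>.\<close>
      let ?\<psi> = "\<lambda>x. \<phi> x - \<phi> 1 * \<epsilon> x"
      have \<psi>: "functional ?\<psi>"
        using \<phi> functional_counit by (intro functional_diff functional_scale)
      have "?\<psi> y = 0" if "y \<in> coradical" for y
        using that \<phi> functional_counit unfolding connected by (auto simp: functionalD counit_one)
      then have "lact ?\<psi> e \<in> ?N'"
        using N(1) e(1) \<psi> NF
        by (intro simple_subquotient_coradical[where N' = ?N' and N = N and F = ?F])
          (auto simp: Q_def N' simple)
      then show ?thesis
        by (simp add: lact_functional_diff lact_functional_scale lact_counit)
    qed
    then have "P (es @ [e])"
      using triangular_snoc e N(1) es(1) by (auto simp: P_def Q_def)
    with es(2) show False by fastforce
  qed
  with es(1) show ?thesis by (auto simp: P_def)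
qed

text \<open>\<open>L\<close> lists the inner terms of the coproduct with their degrees, which are
  positive and hence smaller than \<open>n\<close>; an empty \<open>L\<close> gives the primitive
  elements. These are letters of every positive degree, so degrees are not determined by elements
  and words carry them along.\<close>

inductive letter :: "'b \<Rightarrow> nat \<Rightarrow> bool" where
  letterI: "0 < n \<Longrightarrow>
    (\<forall>p\<in>set L. letter (fst (fst p)) (snd (fst p)) \<and> letter (fst (snd p)) (snd (snd p)) \<and>
       snd (fst p) + snd (snd p) = n) \<Longrightarrow>
    tensor2_eq scale (\<Delta> x) ((x, 1) # (1, x) # map (\<lambda>p. (fst (fst p), fst (snd p))) L) \<Longrightarrow>
    letter x n"

text \<open>
  If \<open>e\<^sub>0, e\<^sub>1, \<dots>\<close> is triangular and \<open>\<Delta> e\<^sub>i = \<Sum>\<^sub>j e\<^sub>j \<otimes> t\<^sub>j\<^sub>i\<close>, then \<open>\<Delta> t\<^sub>j\<^sub>i = \<Sum>\<^sub>l t\<^sub>j\<^sub>l \<otimes> t\<^sub>l\<^sub>i\<close> with a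
  unitriangular matrix \<open>t\<close>, so \<open>t\<^sub>j\<^sub>i\<close> is a letter of degree \<open>i - j\<close>.
\<close>

lemma triangular_span_letters:
  assumes tri: "triangular es"
  shows "set es \<subseteq> span (insert 1 {y. \<exists>n. letter y n})"
proof -
  let ?N = "length es"
  have es: "distinct es" "independent (set es)" using tri by (auto simp: triangular_def)
  obtain \<phi> where \<phi>: "\<And>e. functional (\<phi> e)"
      "\<And>e e'. e \<in> set es \<Longrightarrow> e' \<in> set es \<Longrightarrow> \<phi> e e' = (if e = e' then 1 else 0)"
      "\<And>v. v \<in> span (set es) \<Longrightarrow> v = (\<Sum>e\<in>set es. \<phi> e v *s e)"
    by (rule dual_basis[OF finite_set es(2)]) (rule that)
  \<comment> \<open>The coefficient \<open>t\<close> of the coproduct formula, read off with the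
    dual basis.\<close>
  define T where "T j i = ract (es ! i) (\<phi> (es ! j))" for j i
  have sum_es: "(\<Sum>e\<in>set es. g e) = (\<Sum>j<?N. g (es ! j))" for g :: "'b \<Rightarrow> 'b"
    using es(1) by (intro sum.reindex_bij_betw[symmetric] bij_betw_nth) auto
  have coeff: "\<psi> (T j i) = \<phi> (es ! j) (lact \<psi> (es ! i))" if "functional \<psi>" for \<psi> i j
    using that \<phi>(1) by (simp add: T_def functional_ract functional_lact)
  have lact_es: "lact \<psi> (es ! i) = (\<Sum>j<?N. \<psi> (T j i) *s es ! j)" if "functional \<psi>" "i < ?N" for \<psi> i
    using \<phi>(3)[OF triangular_lact[OF tri _ that(1)], of "es ! i"] that
    by (simp add: sum_es coeff)
  \<comment> \<open>Diagonal entries are 1 and those below are 0: up to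
    \<open>\<psi> 1 *s es ! i\<close>, the action on \<open>es ! i\<close> lands in the span of
    earlier vectors, which the \<open>j\<close>-th coordinate kills.\<close>
  have T_upper: "T j i = (if j = i then 1 else 0)" if ij: "i \<le> j" "j < ?N" for i j
  proof (rule functionals_separate)
    fix \<psi> assume \<psi>: "functional \<psi>"
    let ?d = "lact \<psi> (es ! i) - \<psi> 1 *s es ! i"
    have neq: "es ! j \<noteq> e" if "e \<in> set (take i es)" for e
      using that ij es(1) by (auto simp: in_set_conv_nth nth_eq_iff_index_eq)
    have "span (set (take i es)) \<subseteq> {v. \<phi> (es ! j) v = 0}"
    proof (rule span_minimal)
      show "set (take i es) \<subseteq> {v. \<phi> (es ! j) v = 0}"
        using neq ij set_take_subset[of i es] by (auto simp: \<phi>(2) subset_iff)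
      show "subspace {v. \<phi> (es ! j) v = 0}"
        using \<phi>(1) by (intro subspaceI) (auto simp: functionalD)
    qed
    moreover have "?d \<in> span (set (take i es))"
      using tri \<psi> ij by (simp add: triangular_def)
    ultimately have "\<phi> (es ! j) ?d = 0" by blast
    then have "\<psi> (T j i) = \<psi> 1 * \<phi> (es ! j) (es ! i)"
      using \<phi>(1) \<psi> by (simp add: coeff functionalD)
    then show "\<psi> (T j i) = \<psi> (if j = i then 1 else 0)"
      using \<psi> ij es(1) by (simp add: \<phi>(2) functionalD nth_eq_iff_index_eq)
  qed
  \<comment> \<open>Comultiplicativity of the matrix: the actions commute, so \<open>es ! i\<close>
    is first expanded under \<open>\<psi>\<close>, then its coefficients are taken.\<close>
  have conv_T: "conv \<chi> \<psi> (T j i) = (\<Sum>l<?N. \<chi> (T j l) * \<psi> (T l i))"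
    if \<chi>\<psi>: "functional \<chi>" "functional \<psi>" and i: "i < ?N" for \<chi> \<psi> j i
  proof -
    interpret \<chi>: Vector_Spaces.linear scale "(*)" \<chi> by fact
    interpret r: Vector_Spaces.linear scale scale "\<lambda>x. ract x (\<phi> (es ! j))"
      by (intro linear_ract \<phi>(1))
    have "conv \<chi> \<psi> (T j i) = \<chi> (ract (lact \<psi> (es ! i)) (\<phi> (es ! j)))"
      using \<chi>\<psi> \<phi>(1) by (simp add: functional_lact[symmetric] T_def lact_ract)
    also have "\<dots> = (\<Sum>l<?N. \<psi> (T l i) * \<chi> (T j l))"
      unfolding lact_es[OF \<chi>\<psi>(2) i] by (simp add: r.sum r.scale \<chi>.sum \<chi>.scale T_def)
    finally show ?thesis by (simp add: mult.commute)
  qed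
  have letter_T: "letter (T j i) (i - j)" if "j < i" "i < ?N" for i j
    using that
  proof (induction "i - j" arbitrary: i j rule: less_induct)
    case less
    let ?L = "map (\<lambda>l. ((T j l, l - j), (T l i, i - l))) [Suc j..<i]"
    have "\<forall>p\<in>set ?L. letter (fst (fst p)) (snd (fst p)) \<and> letter (fst (snd p)) (snd (snd p)) \<and>
        snd (fst p) + snd (snd p) = i - j"
      using less by auto
    moreover have "tensor2_eq scale (\<Delta> (T j i))
        ((T j i, 1) # (1, T j i) # map (\<lambda>p. (fst (fst p), fst (snd p))) ?L)"
      unfolding tensor2_eq_comult_iff
    proof (intro allI impI)
      fix \<chi> \<psi> assume \<chi>\<psi>: "functional \<chi>" "functional \<psi>"
      let ?g = "\<lambda>l. \<chi> (T j l) * \<psi> (T l i)"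
      have "conv \<chi> \<psi> (T j i) = (\<Sum>l<?N. ?g l)"
        using conv_T[OF \<chi>\<psi> less.prems(2)] .
      \<comment> \<open>Indices outside the range from \<open>j\<close> to \<open>i\<close>
        contribute 0; \<open>l = i\<close> and \<open>l = j\<close> yield the two outer terms, as
        the diagonal is 1.\<close>
      also have "\<dots> = (\<Sum>l\<in>insert i (insert j {Suc j..<i}). ?g l)"
        using less.prems \<chi>\<psi>
        by (intro sum.mono_neutral_right) (auto simp: T_upper functionalD)
      also have "\<dots> = ?g i + (?g j + (\<Sum>l\<in>{Suc j..<i}. ?g l))"
        using less.prems by simp
      also have "(\<Sum>l\<in>{Suc j..<i}. ?g l) = (\<Sum>l\<leftarrow>[Suc j..<i]. ?g l)"
        by (simp add: interv_sum_list_conv_sum_set_nat)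
      also have "?g i = \<chi> (T j i) * \<psi> 1"
        using less.prems by (simp add: T_upper)
      also have "?g j = \<chi> 1 * \<psi> (T j i)"
        using less.prems by (simp add: T_upper)
      finally show "conv \<chi> \<psi> (T j i) =
          (\<Sum>(a, b)\<leftarrow>(T j i, 1) # (1, T j i) # map (\<lambda>p. (fst (fst p), fst (snd p))) ?L. \<chi> a * \<psi> b)"
        by (simp add: comp_def)
    qed
    ultimately show ?case
      using letterI[of "i - j" ?L "T j i"] less.prems by simp
  qed
  have "es ! i \<in> span (insert 1 {y. \<exists>n. letter y n})" if i: "i < ?N" for i
  proof -
    \<comment> \<open>The counit applied to the first tensor factor; each coefficient on the right
      is a letter, 1 or 0.\<close>
    have "es ! i = (\<Sum>j<?N. \<epsilon> (es ! j) *s T j i)"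
    proof (rule functionals_separate)
      fix \<psi> assume \<psi>: "functional \<psi>"
      interpret \<psi>: Vector_Spaces.linear scale "(*)" \<psi> by fact
      interpret \<epsilon>: Vector_Spaces.linear scale "(*)" \<epsilon> by (rule functional_counit)
      have "\<psi> (es ! i) = \<epsilon> (lact \<psi> (es ! i))"
        using \<psi> functional_counit
        by (simp add: functional_lact functional_ract[symmetric] ract_counit)
      also have "\<dots> = \<psi> (\<Sum>j<?N. \<epsilon> (es ! j) *s T j i)"
        unfolding lact_es[OF \<psi> i] by (simp add: \<epsilon>.sum \<epsilon>.scale \<psi>.sum \<psi>.scale mult.commute)
      finally show "\<psi> (es ! i) = \<psi> (\<Sum>j<?N. \<epsilon> (es ! j) *s T j i)" .
    qed
    also have "\<dots> \<in> span (insert 1 {y. \<exists>n. letter y n})"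
    proof (intro span_sum span_scale)
      fix j assume "j \<in> {..<?N}"
      then show "T j i \<in> span (insert 1 {y. \<exists>n. letter y n})"
        using letter_T[of j i] T_upper[of i j] i
        by (cases "j < i") (auto intro: span_base simp: span_zero)
    qed
    finally show ?thesis .
  qed
  then show ?thesis by (auto simp: in_set_conv_nth)
qed

lemma span_letters: "span (insert 1 {y. \<exists>n. letter y n}) = UNIV"
proof -
  have "x \<in> span (insert 1 {y. \<exists>n. letter y n})" for x
  proof -
    obtain es where es: "triangular es" "x \<in> span (set es)" using ex_triangular by blast
    show ?thesis
      using span_minimal[OF triangular_span_letters[OF es(1)] subspace_span] es(2) by blast
  qed
  then show ?thesis by blast
qed

end

section \<open>Words in letters\<close>

text \<open>The list keeps multiplicities: one entry for each subset of positions. Repetitions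
  become the integer coefficient of the leading term.\<close>

fun splits :: "'a list \<Rightarrow> ('a list \<times> 'a list) list" where
  "splits [] = [([], [])]"
| "splits (x # xs) = map (\<lambda>(l, r). (x # l, r)) (splits xs) @ map (\<lambda>(l, r). (l, x # r)) (splits xs)"

lemma splits_map: "splits (map h xs) = map (\<lambda>(l, r). (map h l, map h r)) (splits xs)"
  by (induction xs) (auto simp: case_prod_unfold)

lemma mset_splits: "(l, r) \<in> set (splits xs) \<Longrightarrow> mset l + mset r = mset xs"
  by (induction xs arbitrary: l r) auto

text \<open>Hence the parts of a splitting of a sorted word are determined by their
  multisets.\<close>

lemma sorted_splits: "sorted xs \<Longrightarrow> (l, r) \<in> set (splits xs) \<Longrightarrow> sorted l \<and> sorted r"
proof (induction xs arbitrary: l r)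
  case (Cons x xs)
  from Cons.prems(2) obtain l' r' where lr: "(l', r') \<in> set (splits xs)"
      "l = x # l' \<and> r = r' \<or> l = l' \<and> r = x # r'"
    by auto
  have "set l' \<union> set r' = set xs"
    using mset_splits[OF lr(1)] by (metis set_mset_mset set_mset_union)
  then have "set l' \<subseteq> set xs" "set r' \<subseteq> set xs" by auto
  then show ?case
    using Cons.IH[OF _ lr(1)] Cons.prems(1) lr(2) by (auto simp: subset_iff)
qed simp

text \<open>Used to see that the coefficient of the leading term is not zero.\<close>

lemma ex_splits: "mset xs = M + N \<Longrightarrow> \<exists>l r. (l, r) \<in> set (splits xs) \<and> mset l = M \<and> mset r = N"
proof (induction xs arbitrary: M N)
  case (Cons x xs)
  show ?case
  proof (cases "x \<in># M")
    case True
    then obtain M' where M: "M = add_mset x M'" by (metis insert_DiffM)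
    with Cons.prems have "mset xs = M' + N" by simp
    from Cons.IH[OF this] obtain l r where
      "(l, r) \<in> set (splits xs)" "mset l = M'" "mset r = N" by blast
    then show ?thesis
      unfolding M by (intro exI[of _ "x # l"] exI[of _ r]) force
  next
    case False
    moreover have "x \<in># M + N" using Cons.prems by (metis list.set_intros(1) set_mset_mset)
    ultimately obtain N' where N: "N = add_mset x N'" by (metis insert_DiffM union_iff)
    with Cons.prems have "mset xs = M + N'" by simp
    from Cons.IH[OF this] obtain l r where
      "(l, r) \<in> set (splits xs)" "mset l = M" "mset r = N'" by blast
    then show ?thesis
      unfolding N by (intro exI[of _ l] exI[of _ "x # r"]) force
  qed
qed simp

lemma splits_length: "(l, r) \<in> set (splits xs) \<Longrightarrow> length l + length r = length xs"
  by (metis mset_splits size_mset size_union)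

context connected_hopf_algebra
begin

section \<open>Coproducts of products of letters\<close>

definition word :: "('b \<times> nat) list \<Rightarrow> bool" where
  "word w \<longleftrightarrow> (\<forall>(x, n)\<in>set w. letter x n)"

definition word_value :: "('b \<times> nat) list \<Rightarrow> 'b" where
  "word_value w = prod_list (map fst w)"

definition word_degree :: "('b \<times> nat) list \<Rightarrow> nat" where
  "word_degree w = sum_list (map snd w)"

lemma word_simps [simp]:
  "word []" "word ((x, n) # w) \<longleftrightarrow> letter x n \<and> word w"
  "word_value [] = 1" "word_value ((x, n) # w) = x * word_value w"
  "word_degree [] = 0" "word_degree ((x, n) # w) = n + word_degree w"
  by (auto simp: word_def word_value_def word_degree_def)

text \<open>Letters have positive degree; so lengths are bounded in each degree, and only the empty
  word has degree 0.\<close>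

lemma length_le_word_degree: "word w \<Longrightarrow> length w \<le> word_degree w"
proof (induction w)
  case (Cons p w)
  obtain x n where p: "p = (x, n)" by fastforce
  with Cons.prems have "letter x n" by simp
  then have "0 < n" by cases
  with Cons p show ?case by simp
qed simp

lemma word_splits:
  assumes "word w" "(l, r) \<in> set (splits w)"
  shows "word l" "word r" "word_degree l + word_degree r = word_degree w"
proof -
  have m: "mset l + mset r = mset w" using assms(2) by (rule mset_splits)
  then have "set l \<union> set r = set w" by (metis set_mset_mset set_mset_union)
  with assms(1) show "word l" "word r" by (auto simp: word_def)
  have "sum_mset (image_mset snd (mset l)) + sum_mset (image_mset snd (mset r)) =
      sum_mset (image_mset snd (mset w))"
    by (simp add: m[symmetric])
  then show "word_degree l + word_degree r = word_degree w"
    by (simp add: word_degree_def sum_mset_sum_list flip: mset_map)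
qed

lemma bilinear_map_mult_args:
  assumes "bilinear_map scale sW B"
  shows "bilinear_map scale sW (\<lambda>c d. B (a * c) (b * d))" "bilinear_map scale sW (\<lambda>c d. B (c * a) (d * b))"
  using bilinear_mapD[OF assms]
  by (auto intro!: bilinear_mapI simp: algebra_simps scale_mult_left scale_mult_right)

lemma comult_mult_bilinear:
  assumes x: "tensor2_eq scale (\<Delta> x) xs" and y: "tensor2_eq scale (\<Delta> y) ys"
    and B: "bilinear_map scale sW B"
  shows "(\<Sum>(a, b)\<leftarrow>\<Delta> (x * y). B a b) = (\<Sum>(a, b)\<leftarrow>xs. \<Sum>(c, d)\<leftarrow>ys. B (a * c) (b * d))"
proof -
  interpret W: vector_space sW using B by (rule bilinear_mapD)
  have flat: "(\<Sum>(a, b)\<leftarrow>concat (map (\<lambda>(a, b). map (\<lambda>(c, d). (a * c, b * d)) vs) us). B a b)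
      = (\<Sum>(a, b)\<leftarrow>us. \<Sum>(c, d)\<leftarrow>vs. B (a * c) (b * d))" for us vs
    by (induction us) (auto simp: comp_def case_prod_unfold)
  have "(\<Sum>(a, b)\<leftarrow>\<Delta> (x * y). B a b) = (\<Sum>(a, b)\<leftarrow>\<Delta> x. \<Sum>(c, d)\<leftarrow>\<Delta> y. B (a * c) (b * d))"
    using tensor2_eq_bilinear[OF comult_mult B, of x y] unfolding flat .
  also have "\<dots> = (\<Sum>(a, b)\<leftarrow>\<Delta> x. \<Sum>(c, d)\<leftarrow>ys. B (a * c) (b * d))"
    using tensor2_eq_bilinear[OF y bilinear_map_mult_args(1)[OF B]] by simp
  also have "\<dots> = (\<Sum>(a, b)\<leftarrow>xs. \<Sum>(c, d)\<leftarrow>ys. B (a * c) (b * d))"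
  proof (rule tensor2_eq_bilinear[OF x, where sW = sW])
    note B' = bilinear_map_mult_args(2)[OF B, unfolded bilinear_map_def]
    show "bilinear_map scale sW (\<lambda>a b. \<Sum>(c, d)\<leftarrow>ys. B (a * c) (b * d))"
      unfolding bilinear_map_def
      by (intro conjI allI linear_sum_list vector_space_axioms W.vector_space_axioms)
        (use B' in \<open>auto simp: case_prod_unfold\<close>)
  qed
  finally show ?thesis .
qed

text \<open>Multiply the coproduct of the first letter \<open>x\<close> with that of the rest. The
  outer terms of \<open>x\<close> put it into one of the two parts, as in \<open>splits\<close>;
  each inner term replaces \<open>x\<close> by two letters of the same total degree, so the word
  count grows.\<close>

lemma comult_word:
  assumes "word w"
  shows "\<exists>L. (\<forall>(u, v)\<in>set L. word u \<and> word v \<and> word_degree u + word_degree v = word_degree w \<and>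
      length w < length u + length v) \<and>
    tensor2_eq scale (\<Delta> (word_value w)) (map (\<lambda>(u, v). (word_value u, word_value v)) (splits w @ L))"
  using assms
proof (induction w)
  case Nil
  show ?case using comult_one by (intro exI[of _ "[]"]) simp
next
  case (Cons p w)
  obtain x n where p: "p = (x, n)" by fastforce
  with Cons.prems have x: "letter x n" and w: "word w" by simp_all
  obtain L where L: "\<forall>(u, v)\<in>set L. word u \<and> word v \<and> word_degree u + word_degree v = word_degree w \<and>
        length w < length u + length v"
      "tensor2_eq scale (\<Delta> (word_value w)) (map (\<lambda>(u, v). (word_value u, word_value v)) (splits w @ L))"
    using Cons.IH[OF w] by blast
  obtain X where X: "\<forall>q\<in>set X. letter (fst (fst q)) (snd (fst q)) \<and> letter (fst (snd q)) (snd (snd q)) \<and>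
        snd (fst q) + snd (snd q) = n"
      "tensor2_eq scale (\<Delta> x) ((x, 1) # (1, x) # map (\<lambda>p. (fst (fst p), fst (snd p))) X)"
    using x by (rule letter.cases) blast
  \<comment> \<open>The excess terms: old ones with \<open>p\<close> on the left or on the right,
    and every term of the rest combined with an inner term of \<open>x\<close>.\<close>
  let ?L = "map (\<lambda>(l, r). (p # l, r)) L @ map (\<lambda>(l, r). (l, p # r)) L @
    concat (map (\<lambda>(q, q'). map (\<lambda>(l, r). (q # l, q' # r)) (splits w @ L)) X)"
  let ?v = "\<lambda>(u, v). (word_value u, word_value v)"
  have "word u \<and> word v \<and> word_degree u + word_degree v = word_degree (p # w) \<and>
      length (p # w) < length u + length v" if uv: "(u, v) \<in> set ?L" for u v
  proof -
    have lr: "word l \<and> word r \<and> word_degree l + word_degree r = word_degree w \<and>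
        length w \<le> length l + length r" if "(l, r) \<in> set (splits w @ L)" for l r
      using that L(1) word_splits[OF w] splits_length by fastforce
    show ?thesis
      using uv L(1) X(1) lr x by (fastforce simp: p)
  qed
  moreover have "tensor2_eq scale (\<Delta> (word_value (p # w))) (map ?v (splits (p # w) @ ?L))"
  proof (rule tensor2_eqI_bilinear[OF vector_space_axioms])
    fix B assume B: "bilinear_map scale (*) B"
    have concat_eq: "(\<Sum>(a, b)\<leftarrow>map ?v (concat (map (\<lambda>(q, q'). map (\<lambda>(l, r). (q # l, q' # r)) M) X')). B a b) =
        (\<Sum>(a, b)\<leftarrow>map (\<lambda>p. (fst (fst p), fst (snd p))) X'. \<Sum>(c, d)\<leftarrow>map ?v M. B (a * c) (b * d))" for M X'
      by (induction X') (auto simp: comp_def case_prod_unfold word_value_def)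
    define M where "M = splits w @ L"
    have "(\<Sum>(a, b)\<leftarrow>\<Delta> (word_value (p # w)). B a b) =
        (\<Sum>(a, b)\<leftarrow>map ?v M. B (x * a) b) + (\<Sum>(a, b)\<leftarrow>map ?v M. B a (x * b)) +
        (\<Sum>(a, b)\<leftarrow>map (\<lambda>p. (fst (fst p), fst (snd p))) X. \<Sum>(c, d)\<leftarrow>map ?v M. B (a * c) (b * d))"
      unfolding p word_simps comult_mult_bilinear[OF X(2) L(2) B] M_def[symmetric]
      by (simp add: add.assoc)
    also have "\<dots> = (\<Sum>(a, b)\<leftarrow>map ?v (map (\<lambda>(l, r). (p # l, r)) M). B a b) +
        (\<Sum>(a, b)\<leftarrow>map ?v (map (\<lambda>(l, r). (l, p # r)) M). B a b) +
        (\<Sum>(a, b)\<leftarrow>map ?v (concat (map (\<lambda>(q, q'). map (\<lambda>(l, r). (q # l, q' # r)) M) X)). B a b)"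
      unfolding concat_eq by (simp add: p comp_def case_prod_unfold)
    also have "\<dots> = (\<Sum>(a, b)\<leftarrow>map ?v (splits (p # w) @ ?L). B a b)"
      unfolding M_def[symmetric] splits.simps map_append sum_list_append
      by (simp add: M_def ac_simps)
    finally show "(\<Sum>(a, b)\<leftarrow>\<Delta> (word_value (p # w)). B a b) =
        (\<Sum>(a, b)\<leftarrow>map ?v (splits (p # w) @ ?L). B a b)" .
  qed
  ultimately show ?case by (intro exI[of _ ?L]) fast
qed

end

section \<open>Leading terms in the convolution algebra\<close>

lemma sum_list_splits_Nil:
  assumes "\<And>l r. (l, r) \<in> set (splits w) \<Longrightarrow> l \<noteq> [] \<Longrightarrow> h l r = (0 :: 'c::comm_monoid_add)"
  shows "(\<Sum>(l, r)\<leftarrow>splits w. h l r) = h [] w"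
  using assms
proof (induction w arbitrary: h)
  case (Cons x w)
  have "(\<Sum>(l, r)\<leftarrow>splits w. h (x # l) r) = (\<Sum>p\<leftarrow>splits w. 0)"
    using Cons.prems by (intro arg_cong[of _ _ sum_list] map_cong) (force simp: case_prod_unfold)+
  moreover have "(\<Sum>(l, r)\<leftarrow>splits w. h l (x # r)) = h [] (x # w)"
    using Cons.prems by (intro Cons.IH) force
  ultimately show ?case by (simp add: comp_def case_prod_unfold)
qed simp

lemma sum_list_if_const:
  "(\<Sum>p\<leftarrow>ps. if P p then v else (0 :: 'c::ab_group_add)) = (\<Sum>p\<leftarrow>filter P ps. v)"
  by (induction ps) auto

locale connected_hopf_convolution =
  connected_hopf_algebra scale \<Delta> \<epsilon> antipode + R: assoc_algebra smultR
  for scale :: "'k::field_char_0 \<Rightarrow> 'h::{ring, monoid_mult} \<Rightarrow> 'h" (infixr \<open>*s\<close> 75)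
    and \<Delta> :: "'h \<Rightarrow> ('h \<times> 'h) list"
    and \<epsilon> :: "'h \<Rightarrow> 'k"
    and antipode :: "'h \<Rightarrow> 'h"
    and smultR :: "'k \<Rightarrow> 'r::{ring, monoid_mult} \<Rightarrow> 'r"
begin

section \<open>The convolution product of linear maps\<close>

abbreviation klinear :: "('h \<Rightarrow> 'r) \<Rightarrow> bool" where
  "klinear \<equiv> Vector_Spaces.linear scale smultR"

definition rconv :: "('h \<Rightarrow> 'r) \<Rightarrow> ('h \<Rightarrow> 'r) \<Rightarrow> 'h \<Rightarrow> 'r" where
  "rconv f g h = (\<Sum>(a, b)\<leftarrow>\<Delta> h. f a * g b)"

lemma klinearI:
  "(\<And>x y. f (x + y) = f x + f y) \<Longrightarrow> (\<And>c x. f (c *s x) = smultR c (f x)) \<Longrightarrow> klinear f"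
  by (simp add: Vector_Spaces.linear_iff vector_space_axioms R.vector_space_axioms)

lemma klinearD:
  assumes "klinear f"
  shows "f (x + y) = f x + f y" "f (c *s x) = smultR c (f x)"
  using assms by (simp_all add: Vector_Spaces.linear_iff)

lemma bilinear_klinear_mult:
  assumes "klinear f" "klinear g"
  shows "bilinear_map scale smultR (\<lambda>a b. f a * g b)"
  using assms
  by (auto intro!: bilinear_mapI simp: vector_space_axioms R.vector_space_axioms klinearD algebra_simps
      R.scale_mult_left R.scale_mult_right)

lemma klinear_rconv: "klinear f \<Longrightarrow> klinear g \<Longrightarrow> klinear (rconv f g)"
  unfolding rconv_def[abs_def] by (intro comult_linear bilinear_klinear_mult)

lemma rconv_assoc:
  assumes "klinear f" "klinear g" "klinear h"
  shows "rconv (rconv f g) h = rconv f (rconv g h)"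
proof
  fix x
  have "rconv (rconv f g) h x = (\<Sum>(a, b)\<leftarrow>\<Delta> x. \<Sum>(a\<^sub>1, a\<^sub>2)\<leftarrow>\<Delta> a. f a\<^sub>1 * g a\<^sub>2 * h b)"
    by (simp add: rconv_def sum_list_mult_const case_prod_unfold)
  also have "\<dots> = (\<Sum>(a, b)\<leftarrow>\<Delta> x. \<Sum>(b\<^sub>1, b\<^sub>2)\<leftarrow>\<Delta> b. f a * g b\<^sub>1 * h b\<^sub>2)"
    using assms
    by (intro coassoc_trilinear[where sW = smultR] klinearI)
      (auto simp: klinearD algebra_simps R.scale_mult_left R.scale_mult_right)
  also have "\<dots> = rconv f (rconv g h) x"
    by (simp add: rconv_def sum_list_const_mult case_prod_unfold mult.assoc)
  finally show "rconv (rconv f g) h x = rconv f (rconv g h) x" .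
qed

lemma klinear_unit: "klinear (\<lambda>h. smultR (\<epsilon> h) 1)"
  using functional_counit by (intro klinearI) (simp_all add: functionalD R.scale_left_distrib)

lemma rconv_unit:
  assumes "klinear f"
  shows "rconv (\<lambda>h. smultR (\<epsilon> h) 1) f = f" "rconv f (\<lambda>h. smultR (\<epsilon> h) 1) = f"
proof -
  have "(\<Sum>(a, b)\<leftarrow>\<Delta> x. f (\<epsilon> a *s b)) = f x" "(\<Sum>(a, b)\<leftarrow>\<Delta> x. f (\<epsilon> b *s a)) = f x" for x
    using arg_cong[OF counit_left[of x], of f] arg_cong[OF counit_right[of x], of f]
    by (simp_all add: sum_list_linear[OF assms] case_prod_unfold)
  then show "rconv (\<lambda>h. smultR (\<epsilon> h) 1) f = f" "rconv f (\<lambda>h. smultR (\<epsilon> h) 1) = f"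
    using assms by (simp_all add: rconv_def fun_eq_iff klinearD R.scale_mult_left R.scale_mult_right)
qed

text \<open>Records vanishing only, not the survival of some word of degree \<open>n\<close> and
  length \<open>d\<close>. So the bounds add under convolution even if \<open>R\<close> has zero
  divisors, and the bounds 0, 0 fit every map.\<close>

definition leading :: "('h \<Rightarrow> 'r) \<Rightarrow> nat \<Rightarrow> nat \<Rightarrow> bool" where
  "leading f n d \<longleftrightarrow> (\<forall>w. word w \<longrightarrow>
     word_degree w < n \<or> word_degree w = n \<and> d < length w \<longrightarrow> f (word_value w) = 0)"

text \<open>Since 1 and the letters span \<open>H\<close>, some word of length at most 1 survives;
  minimize the degree, then maximize the length, which the degree bounds.\<close>

lemma ex_leading:
  assumes f: "klinear f" "f x \<noteq> 0"
  shows "\<exists>w. word w \<and> leading f (word_degree w) (length w) \<and> f (word_value w) \<noteq> 0"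
proof -
  interpret p: vector_space_pair scale smultR
    by (rule vector_space_pair.intro[OF vector_space_axioms R.vector_space_axioms])
  define P where "P w \<longleftrightarrow> word w \<and> f (word_value w) \<noteq> 0" for w
  have "\<exists>w. P w"
  proof (rule ccontr)
    assume nex: "\<not> (\<exists>w. P w)"
    have "f y = 0" if "y \<in> insert 1 {y. \<exists>n. letter y n}" for y
    proof (cases "y = 1")
      case True
      with nex show ?thesis by (auto simp: P_def dest: spec[of _ "[]"])
    next
      case False
      with that obtain n where "letter y n" by auto
      with nex show ?thesis by (auto simp: P_def dest: spec[of _ "[(y, n)]"])
    qed
    then have "f x = 0"
      using p.linear_eq_0_on_span[OF f(1), of "insert 1 {y. \<exists>n. letter y n}" x] span_letters by simp
    with f(2) show False ..
  qed
  then obtain w\<^sub>0 where w\<^sub>0: "P w\<^sub>0" "\<And>w. P w \<Longrightarrow> word_degree w\<^sub>0 \<le> word_degree w"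
    using ex_has_least_nat[of P _ word_degree] by blast
  let ?n = "word_degree w\<^sub>0"
  define Q where "Q w \<longleftrightarrow> P w \<and> word_degree w = ?n" for w
  have "Q w\<^sub>0" using w\<^sub>0(1) by (simp add: Q_def)
  moreover have "\<forall>w. Q w \<longrightarrow> length w < Suc ?n"
    using length_le_word_degree by (fastforce simp: Q_def P_def)
  ultimately obtain w where w: "Q w" "\<And>w'. Q w' \<Longrightarrow> length w' \<le> length w"
    using ex_has_greatest_nat[of Q w\<^sub>0 length] by blast
  have "leading f ?n (length w)"
    unfolding leading_def
  proof (intro allI impI, rule ccontr)
    fix w' assume w': "word w'" "word_degree w' < ?n \<or> word_degree w' = ?n \<and> length w < length w'"
      "f (word_value w') \<noteq> 0"
    then have "P w'" by (simp add: P_def)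
    with w\<^sub>0(2)[of w'] w' have "word_degree w' = ?n" "length w < length w'" by auto
    with w(2)[of w'] \<open>P w'\<close> show False by (simp add: Q_def)
  qed
  with w(1) show ?thesis by (auto simp: Q_def P_def)
qed

text \<open>If neither factor were beyond its own bounds, the degrees would be at least
  \<open>n\<close> and \<open>m\<close>; equality in the sum makes them exact, and then the lengths
  are at most \<open>d\<close> and \<open>e\<close>.\<close>

lemma leading_mult_eq_0:
  assumes "leading f n d" "leading g m e" "word l" "word r"
    and "word_degree l + word_degree r < n + m \<or>
      word_degree l + word_degree r = n + m \<and> d + e < length l + length r"
  shows "f (word_value l) * g (word_value r) = 0"
proof -
  consider "word_degree l < n \<or> word_degree l = n \<and> d < length l"
    | "word_degree r < m \<or> word_degree r = m \<and> e < length r"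
    using assms(5) by linarith
  then show ?thesis
    using assms(1-4) by cases (auto simp: leading_def)
qed

text \<open>The excess terms of the coproduct have the same total degree and strictly more letters,
  so they are killed even at the boundary length \<open>d + e\<close>.\<close>

lemma rconv_word:
  assumes fg: "klinear f" "klinear g" and lead: "leading f n d" "leading g m e"
    and w: "word w" "word_degree w < n + m \<or> word_degree w = n + m \<and> d + e \<le> length w"
  shows "rconv f g (word_value w) = (\<Sum>(l, r)\<leftarrow>splits w. f (word_value l) * g (word_value r))"
proof -
  obtain L where L: "\<And>u v. (u, v) \<in> set L \<Longrightarrow> word u \<and> word v \<and>
        word_degree u + word_degree v = word_degree w \<and> length w < length u + length v"
      "tensor2_eq scale (\<Delta> (word_value w)) (map (\<lambda>(u, v). (word_value u, word_value v)) (splits w @ L))"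
    using comult_word[OF w(1)] by blast
  let ?h = "\<lambda>(l, r). f (word_value l) * g (word_value r)"
  have "rconv f g (word_value w) = (\<Sum>p\<leftarrow>splits w. ?h p) + (\<Sum>p\<leftarrow>L. ?h p)"
    unfolding rconv_def tensor2_eq_bilinear[OF L(2) bilinear_klinear_mult[OF fg]]
    by (simp add: comp_def case_prod_unfold)
  also have "(\<Sum>p\<leftarrow>L. ?h p) = (\<Sum>p\<leftarrow>L. 0)"
  proof (intro arg_cong[of _ _ sum_list] map_cong refl)
    fix p assume "p \<in> set L"
    then show "?h p = 0"
      using L(1)[of "fst p" "snd p"] w(2)
      by (auto simp: case_prod_unfold intro!: leading_mult_eq_0[OF lead])
  qed
  finally show ?thesis by simp
qed

lemma leading_rconv:
  assumes "klinear f" "klinear g" "leading f n d" "leading g m e"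
  shows "leading (rconv f g) (n + m) (d + e)"
  unfolding leading_def
proof (intro allI impI)
  fix w assume w: "word w" "word_degree w < n + m \<or> word_degree w = n + m \<and> d + e < length w"
  have "f (word_value l) * g (word_value r) = 0" if "(l, r) \<in> set (splits w)" for l r
    using w word_splits[OF w(1) that] splits_length[OF that]
    by (intro leading_mult_eq_0[OF assms(3,4)]) auto
  then have "(\<Sum>(l, r)\<leftarrow>splits w. f (word_value l) * g (word_value r)) = (\<Sum>p\<leftarrow>splits w. 0)"
    by (intro arg_cong[of _ _ sum_list] map_cong) auto
  then show "rconv f g (word_value w) = 0"
    using rconv_word[OF assms w(1)] w(2) by auto
qed

lemma leading_0: "leading f 0 0"
  using length_le_word_degree by (fastforce simp: leading_def)

text \<open>Give \<open>s\<close> the bounds 0, 0. A nonempty left part uses up positive degree,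
  leaving \<open>g\<close> a word of degree below \<open>m\<close>; only the splitting with empty
  left part survives.\<close>

lemma rconv_leading_word:
  assumes "klinear s" "klinear g" "leading g m e" "word w" "word_degree w = m" "length w = e"
  shows "rconv s g (word_value w) = s 1 * g (word_value w)"
proof -
  have "rconv s g (word_value w) = (\<Sum>(l, r)\<leftarrow>splits w. s (word_value l) * g (word_value r))"
    using assms by (intro rconv_word[OF assms(1,2) leading_0 assms(3)]) auto
  also have "\<dots> = s (word_value []) * g (word_value w)"
  proof (rule sum_list_splits_Nil)
    fix l r assume lr: "(l, r) \<in> set (splits w)" "l \<noteq> []"
    then have "word_degree r < m"
      using word_splits[OF assms(4) lr(1)] length_le_word_degree[of l] assms(5)
      by (cases l) auto
    then show "s (word_value l) * g (word_value r) = 0"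
      using assms(3) word_splits[OF assms(4) lr(1)] by (simp add: leading_def)
  qed
  finally show ?thesis by simp
qed

text \<open>
  Number the letters of a leading word of \<open>f\<close> followed by one of \<open>g\<close>, and let \<open>\<alpha>\<close>, \<open>\<beta>\<close> be the largest
  multisets of letters whose sorted words have the leading degree and length and are not killed by
  \<open>f\<close>, \<open>g\<close>. On the sorted word of \<open>\<alpha> + \<beta>\<close> every splitting other than \<open>(\<alpha>, \<beta>)\<close> contributes zero, and
  the number \<open>c\<close> of splittings equal to \<open>(\<alpha>, \<beta>)\<close> is invertible in characteristic 0.
\<close>

lemma rconv_leading_term:
  assumes f: "klinear f" "f x\<^sub>0 \<noteq> 0" and g: "klinear g" "g y\<^sub>0 \<noteq> 0"
  shows "\<exists>x y w. f x \<noteq> 0 \<and> g y \<noteq> 0 \<and> (f = g \<longrightarrow> x = y) \<and>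
    (\<forall>s. klinear s \<longrightarrow> rconv f (rconv s g) w = 0 \<longrightarrow> f x * s 1 * g y = 0)"
proof -
  \<comment> \<open>The word is chosen as a function of the map, so that \<open>f = g\<close> leads
    to the same word, the same bounds and finally \<open>x = y\<close>.\<close>
  have "\<forall>h\<in>{f, g}. \<exists>w. word w \<and> leading h (word_degree w) (length w) \<and> h (word_value w) \<noteq> 0"
    using ex_leading[OF f] ex_leading[OF g] by simp
  from bchoice[OF this] obtain W where W: "\<forall>h\<in>{f, g}. word (W h) \<and>
      leading h (word_degree (W h)) (length (W h)) \<and> h (word_value (W h)) \<noteq> 0" ..
  define N where "N h = word_degree (W h)" for h
  define D where "D h = length (W h)" for h
  have lf: "leading f (N f) (D f)" "word (W f)" "f (word_value (W f)) \<noteq> 0"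
    and lg: "leading g (N g) (D g)" "word (W g)" "g (word_value (W g)) \<noteq> 0"
    using W by (simp_all add: N_def D_def)
  define zs where "zs = W f @ W g"
  \<comment> \<open>Positions in \<open>zs\<close> stand for letters, since natural numbers supply
    the linear order behind sorted words and the multiset order.\<close>
  define I where "I = {..<length zs}"
  define wd where "wd is = map ((!) zs) is" for "is"
  have zs: "word zs" using lf lg by (auto simp: zs_def word_def)
  have word_wd: "word (wd is)" if "set is \<subseteq> I" for "is"
    using zs that by (auto simp: wd_def word_def I_def dest!: nth_mem split: prod.splits)
  have degree_wd: "word_degree (wd is) = (\<Sum>i\<in>#mset is. snd (zs ! i))" for "is"
    by (simp add: wd_def word_degree_def comp_def sum_mset_sum_list flip: mset_map)
  define cand where "cand h = {M. set_mset M \<subseteq> I \<and> size M = D h \<and>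
    word_degree (wd (sorted_list_of_multiset M)) = N h \<and>
    h (word_value (wd (sorted_list_of_multiset M))) \<noteq> 0}" for h
  have finite_cand: "finite (cand h)" for h
  proof (rule finite_subset)
    show "cand h \<subseteq> mset ` {is. set is \<subseteq> I \<and> length is = D h}"
    proof
      fix M assume "M \<in> cand h"
      then have "set (sorted_list_of_multiset M) \<subseteq> I" "length (sorted_list_of_multiset M) = D h"
        by (auto simp: cand_def simp flip: size_mset)
      then show "M \<in> mset ` {is. set is \<subseteq> I \<and> length is = D h}"
        by (intro image_eqI[of _ _ "sorted_list_of_multiset M"]) auto
    qed
    show "finite (mset ` {is. set is \<subseteq> I \<and> length is = D h})"
      by (intro finite_imageI finite_lists_length_eq) (simp add: I_def)
  qed
  have sorted_eq: "sorted_list_of_multiset (mset is) = is" if "sorted is" for "is" :: "nat list"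
    using that by (simp add: sorted_list_of_multiset_mset sort_key_id_if_sorted)
  have "wd [0..<length (W f)] = W f"
    by (rule nth_equalityI) (auto simp: wd_def zs_def nth_append)
  then have "mset [0..<length (W f)] \<in> cand f"
    using lf unfolding cand_def mem_Collect_eq by (subst (1 2) sorted_eq) (auto simp: I_def zs_def N_def D_def)
  then have nef: "cand f \<noteq> {}" by blast
  have "wd [length (W f)..<length zs] = W g"
    by (rule nth_equalityI) (auto simp: wd_def zs_def nth_append)
  then have "mset [length (W f)..<length zs] \<in> cand g"
    using lg unfolding cand_def mem_Collect_eq by (subst (1 2) sorted_eq) (auto simp: I_def zs_def N_def D_def)
  then have neg: "cand g \<noteq> {}" by blast
  define \<alpha> where "\<alpha> = Max (cand f)"
  define \<beta> where "\<beta> = Max (cand g)"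
  have \<alpha>: "\<alpha> \<in> cand f" and \<beta>: "\<beta> \<in> cand g"
    unfolding \<alpha>_def \<beta>_def using finite_cand nef neg by (auto intro: Max_in)
  define x where "x = word_value (wd (sorted_list_of_multiset \<alpha>))"
  define y where "y = word_value (wd (sorted_list_of_multiset \<beta>))"
  define ws where "ws = sorted_list_of_multiset (\<alpha> + \<beta>)"
  have ws: "set ws \<subseteq> I" "sorted ws" "mset ws = \<alpha> + \<beta>"
    using \<alpha> \<beta> by (auto simp: ws_def cand_def)
  have deg_ws: "word_degree (wd ws) = N f + N g"
    using \<alpha> \<beta> by (simp add: degree_wd ws(3) cand_def)
  have len_ws: "length (wd ws) = D f + D g"
    using \<alpha> \<beta> arg_cong[OF ws(3), of size] by (simp add: wd_def cand_def)
  have "f x * s 1 * g y = 0" if s: "klinear s" and zero: "rconv f (rconv s g) (word_value (wd ws)) = 0" for s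
  proof -
    have sum_list_const_scale: "(\<Sum>r\<leftarrow>rs. v) = smultR (of_nat (length rs)) v" for rs :: "(nat list \<times> nat list) list" and v
      by (induction rs) (simp_all add: R.scale_left_distrib)
    let ?P = "\<lambda>(p, q). mset p = \<alpha> \<and> mset q = \<beta>"
    let ?t = "f x * (s 1 * g y)"
    \<comment> \<open>Convolving with \<open>s\<close> preserves the bounds of
      \<open>g\<close>.\<close>
    note lsg = leading_rconv[OF s g(1) leading_0 lg(1), simplified]
    have summand: "f (word_value (wd p)) * rconv s g (word_value (wd q)) = (if ?P (p, q) then ?t else 0)"
      if pq: "(p, q) \<in> set (splits ws)" for p q
    proof -
      have m: "mset p + mset q = \<alpha> + \<beta>" using mset_splits[OF pq] ws(3) by simp
      then have "set p \<union> set q = set ws"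
        using ws(3) by (metis set_mset_mset set_mset_union)
      then have sub: "set p \<subseteq> I" "set q \<subseteq> I" using ws(1) by auto
      have srt: "sorted_list_of_multiset (mset p) = p" "sorted_list_of_multiset (mset q) = q"
        using sorted_splits[OF ws(2) pq] by (simp_all only: sorted_eq)
      have deg: "word_degree (wd p) + word_degree (wd q) = N f + N g"
        using arg_cong[OF m, of "\<lambda>M. \<Sum>i\<in>#M. snd (zs ! i)"] deg_ws
        by (simp add: degree_wd ws(3))
      have len: "length p + length q = D f + D g"
        using splits_length[OF pq] len_ws by (simp add: wd_def)
      have rsg: "rconv s g (word_value (wd q)) = s 1 * g (word_value (wd q))"
        if "word_degree (wd q) = N g" "length q = D g"
        using that lg word_wd[OF sub(2)]
        by (intro rconv_leading_word[OF s g(1)]) (auto simp: wd_def)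
      show ?thesis
      proof (cases "f (word_value (wd p)) = 0 \<or> rconv s g (word_value (wd q)) = 0")
        case True
        \<comment> \<open>For a splitting of type \<open>(\<alpha>, \<beta>)\<close> the product
          equals \<open>?t\<close>, so \<open>?t\<close> vanishes with either factor.\<close>
        have "?t = 0" if "?P (p, q)"
        proof -
          have "wd p = wd (sorted_list_of_multiset \<alpha>)" "wd q = wd (sorted_list_of_multiset \<beta>)"
            using that srt by auto
          moreover have "word_degree (wd q) = N g" "length q = D g"
            using that \<beta> srt by (auto simp: cand_def simp flip: size_mset)
          ultimately show ?thesis using True rsg by (auto simp: x_def y_def)
        qed
        with True show ?thesis by auto
      next
        case False
        \<comment> \<open>Neither part lies below its least degree and the total is fixed, so both
          degrees are exact; then neither exceeds its greatest length, so both lengths are exact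
          too.\<close>
        have "\<not> (word_degree (wd p) < N f \<or> word_degree (wd p) = N f \<and> D f < length (wd p))"
          using False lf word_wd[OF sub(1)] by (auto simp: leading_def)
        moreover have "\<not> (word_degree (wd q) < N g \<or> word_degree (wd q) = N g \<and> D g < length (wd q))"
          using False lsg word_wd[OF sub(2)] by (auto simp: leading_def)
        ultimately have eq: "word_degree (wd p) = N f" "word_degree (wd q) = N g"
            "length p = D f" "length q = D g"
          using deg len by (auto simp: wd_def)
        have "mset p \<in> cand f" "mset q \<in> cand g"
          using False eq rsg sub unfolding cand_def mem_Collect_eq srt by auto
        then have "mset p \<le> \<alpha>" "mset q \<le> \<beta>"
          using finite_cand by (simp_all add: \<alpha>_def \<beta>_def)
        \<comment> \<open>The multiset order is strictly compatible with addition: a strict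
          inequality in either part would contradict the equal sums.\<close>
        with m have "mset p = \<alpha>" "mset q = \<beta>"
          using add_less_le_mono[of "mset p" \<alpha> "mset q" \<beta>] add_le_less_mono[of "mset p" \<alpha> "mset q" \<beta>]
          by (auto simp: order.order_iff_strict)
        moreover from this have "p = sorted_list_of_multiset \<alpha>" "q = sorted_list_of_multiset \<beta>"
          using srt by simp_all
        ultimately show ?thesis using rsg eq by (simp add: x_def y_def)
      qed
    qed
    have "0 = (\<Sum>(l, r)\<leftarrow>splits (wd ws). f (word_value l) * rconv s g (word_value r))"
      using zero deg_ws len_ws word_wd[OF ws(1)] lf
      by (subst rconv_word[symmetric, OF f(1) klinear_rconv[OF s g(1)] _ lsg]) auto
    also have "\<dots> = (\<Sum>(p, q)\<leftarrow>splits ws. f (word_value (wd p)) * rconv s g (word_value (wd q)))"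
      unfolding wd_def splits_map by (simp add: comp_def case_prod_unfold)
    also have "\<dots> = (\<Sum>r\<leftarrow>splits ws. if ?P r then ?t else 0)"
    proof (intro arg_cong[of _ _ sum_list] map_cong refl)
      fix r assume "r \<in> set (splits ws)"
      then show "(case r of (p, q) \<Rightarrow> f (word_value (wd p)) * rconv s g (word_value (wd q))) =
          (if ?P r then ?t else 0)"
        using summand[of "fst r" "snd r"] by (simp add: case_prod_unfold)
    qed
    also have "\<dots> = (\<Sum>r\<leftarrow>filter ?P (splits ws). ?t)"
      by (rule sum_list_if_const)
    also have "\<dots> = smultR (of_nat (length (filter ?P (splits ws)))) ?t"
      by (rule sum_list_const_scale)
    finally have "smultR (of_nat (length (filter ?P (splits ws)))) ?t = 0" ..
    moreover have "filter ?P (splits ws) \<noteq> []"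
      using ex_splits[OF ws(3)] by (auto simp: filter_empty_conv)
    ultimately show ?thesis by (simp add: mult.assoc)
  qed
  moreover have "f x \<noteq> 0" "g y \<noteq> 0"
    using \<alpha> \<beta> by (simp_all add: cand_def x_def y_def)
  moreover have "f = g \<longrightarrow> x = y"
    by (auto simp: x_def y_def \<alpha>_def \<beta>_def)
  ultimately show ?thesis by blast
qed

end

section \<open>Prime, semiprime and domain conditions\<close>

lemma ideal_prod_eq_zero_iff:
  assumes "ideal I R" "ideal J R"
  shows "ideal_prod R I J = {\<zero>\<^bsub>R\<^esub>} \<longleftrightarrow> (\<forall>i\<in>I. \<forall>j\<in>J. i \<otimes>\<^bsub>R\<^esub> j = \<zero>\<^bsub>R\<^esub>)"
proof
  assume "ideal_prod R I J = {\<zero>\<^bsub>R\<^esub>}"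
  then show "\<forall>i\<in>I. \<forall>j\<in>J. i \<otimes>\<^bsub>R\<^esub> j = \<zero>\<^bsub>R\<^esub>"
    using ideal_prod.prod[of _ I _ J R] by auto
next
  assume zero: "\<forall>i\<in>I. \<forall>j\<in>J. i \<otimes>\<^bsub>R\<^esub> j = \<zero>\<^bsub>R\<^esub>"
  have 0: "\<zero>\<^bsub>R\<^esub> \<in> I" "\<zero>\<^bsub>R\<^esub> \<in> J"
    using assms by (auto intro: additive_subgroup.zero_closed ideal.axioms(1))
  interpret ideal I R by fact
  have "x = \<zero>\<^bsub>R\<^esub>" if "x \<in> ideal_prod R I J" for x
    using that by induction (simp_all add: zero)
  moreover have "\<zero>\<^bsub>R\<^esub> \<in> ideal_prod R I J"
    using ideal_prod.prod[OF 0, of R] zero 0 by simp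
  ultimately show "ideal_prod R I J = {\<zero>\<^bsub>R\<^esub>}" by blast
qed

text \<open>Closure under negation comes from multiplication by \<open>- 1\<close>.\<close>

lemma ideal_ring_of_type:
  fixes I :: "'r::{ring, monoid_mult} set"
  assumes R: "ring (ring_of_type :: 'r ring)"
    and I: "0 \<in> I" "\<And>x y. x \<in> I \<Longrightarrow> y \<in> I \<Longrightarrow> x + y \<in> I"
      "\<And>x r. x \<in> I \<Longrightarrow> r * x \<in> I" "\<And>x r. x \<in> I \<Longrightarrow> x * r \<in> I"
  shows "ideal I (ring_of_type :: 'r ring)"
proof (rule idealI[OF R])
  interpret R: ring "ring_of_type :: 'r ring" by fact
  have "inv\<^bsub>add_monoid (ring_of_type :: 'r ring)\<^esub> x = - x" for x :: 'r
    using R.minus_equality[of "- x" x] by (simp add: ring_of_type_def a_inv_def)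
  moreover have "- x \<in> I" if "x \<in> I" for x
    using I(3)[OF that, of "- 1"] by simp
  ultimately show "subgroup I (add_monoid (ring_of_type :: 'r ring))"
    using I by (intro subgroup.intro) (auto simp: ring_of_type_def)
qed (use I in \<open>auto simp: ring_of_type_def\<close>)

section \<open>Annihilators and elementwise primeness\<close>

lemma ideal_right_annihilator:
  fixes X :: "'r::{ring, monoid_mult} set"
  assumes "ring (ring_of_type :: 'r ring)"
  shows "ideal {y. \<forall>x\<in>X. \<forall>r. x * r * y = 0} (ring_of_type :: 'r ring)"
proof (rule ideal_ring_of_type[OF assms])
  fix y s assume y: "y \<in> {y. \<forall>x\<in>X. \<forall>r. x * r * y = 0}"
  have "x * r * (s * y) = x * (r * s) * y" for x r by (simp only: mult.assoc)
  with y show "s * y \<in> {y. \<forall>x\<in>X. \<forall>r. x * r * y = 0}" by simp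
  have "x * r * (y * s) = x * r * y * s" for x r by (simp only: mult.assoc)
  with y show "y * s \<in> {y. \<forall>x\<in>X. \<forall>r. x * r * y = 0}" by simp
qed (simp_all add: distrib_left)

lemma ideal_left_annihilator:
  fixes Y :: "'r::{ring, monoid_mult} set"
  assumes "ring (ring_of_type :: 'r ring)"
  shows "ideal {x. \<forall>y\<in>Y. \<forall>r. x * r * y = 0} (ring_of_type :: 'r ring)"
proof (rule ideal_ring_of_type[OF assms])
  fix x s assume x: "x \<in> {x. \<forall>y\<in>Y. \<forall>r. x * r * y = 0}"
  have "s * x * r * y = s * (x * r * y)" for r y by (simp only: mult.assoc)
  with x show "s * x \<in> {x. \<forall>y\<in>Y. \<forall>r. x * r * y = 0}" by simp
  have "x * s * r * y = x * (s * r) * y" for r y by (simp only: mult.assoc)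
  with x show "x * s \<in> {x. \<forall>y\<in>Y. \<forall>r. x * r * y = 0}" by simp
qed (simp_all add: distrib_right)

text \<open>Annihilators serve in place of generated ideals: \<open>J\<close> consists of the
  \<open>y\<close> with \<open>a R y = 0\<close>, and \<open>I\<close> of the \<open>x\<close> with
  \<open>x R J = 0\<close>. Then \<open>I J = 0\<close>, while \<open>a\<close> lies in
  \<open>I\<close> and \<open>b\<close> in \<open>J\<close>.\<close>

lemma prime_ring_elements:
  fixes a b :: "'r::{ring, monoid_mult}"
  assumes R: "prime_ring (ring_of_type :: 'r ring)" and ab: "\<And>r. a * r * b = 0"
  shows "a = 0 \<or> b = 0"
proof -
  have ring: "ring (ring_of_type :: 'r ring)" using R by (simp add: prime_ring_def)
  define J where "J = {y. \<forall>x\<in>{a}. \<forall>r. x * r * y = 0}"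
  define I where "I = {x. \<forall>y\<in>J. \<forall>r. x * r * y = 0}"
  have IJ: "ideal I (ring_of_type :: 'r ring)" "ideal J (ring_of_type :: 'r ring)"
    unfolding I_def J_def by (rule ideal_left_annihilator[OF ring] ideal_right_annihilator[OF ring])+
  have "x * y = 0" if "x \<in> I" "y \<in> J" for x y
    using that(1) unfolding I_def using that(2) by (auto dest!: bspec spec[of _ 1])
  then have "ideal_prod (ring_of_type :: 'r ring) I J = {\<zero>\<^bsub>ring_of_type\<^esub>}"
    unfolding ideal_prod_eq_zero_iff[OF IJ] by (simp add: ring_of_type_def)
  with R IJ have "I = {\<zero>\<^bsub>ring_of_type\<^esub>} \<or> J = {\<zero>\<^bsub>ring_of_type\<^esub>}"
    by (simp add: prime_ring_def)
  moreover have "a \<in> I" "b \<in> J" using ab by (auto simp: I_def J_def)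
  ultimately show ?thesis by (auto simp: ring_of_type_def)
qed

text \<open>With the annihilators of the prime case, \<open>a\<close> lies in
  \<open>I \<inter> J\<close>, an ideal of square zero.\<close>

lemma semiprime_ring_elements:
  fixes a :: "'r::{ring, monoid_mult}"
  assumes R: "semiprime_ring (ring_of_type :: 'r ring)" and a: "\<And>r. a * r * a = 0"
  shows "a = 0"
proof -
  have ring: "ring (ring_of_type :: 'r ring)" using R by (simp add: semiprime_ring_def)
  interpret ring "ring_of_type :: 'r ring" by fact
  define J where "J = {y. \<forall>x\<in>{a}. \<forall>r. x * r * y = 0}"
  define I where "I = {x. \<forall>y\<in>J. \<forall>r. x * r * y = 0}"
  have IJ: "ideal (I \<inter> J) (ring_of_type :: 'r ring)"
    unfolding I_def J_def
    by (intro i_intersect ideal_left_annihilator[OF ring] ideal_right_annihilator[OF ring])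
  have "x * y = 0" if "x \<in> I" "y \<in> J" for x y
    using that(1) unfolding I_def using that(2) by (auto dest!: bspec spec[of _ 1])
  then have "ideal_prod (ring_of_type :: 'r ring) (I \<inter> J) (I \<inter> J) = {\<zero>\<^bsub>ring_of_type\<^esub>}"
    unfolding ideal_prod_eq_zero_iff[OF IJ IJ] by (simp add: ring_of_type_def)
  with R IJ have "I \<inter> J = {\<zero>\<^bsub>ring_of_type\<^esub>}"
    by (simp add: semiprime_ring_def)
  moreover have "a \<in> I \<inter> J" using a by (auto simp: I_def J_def)
  ultimately show ?thesis by (auto simp: ring_of_type_def)
qed

section \<open>The ring of linear maps\<close>

context connected_hopf_convolution
begin

abbreviation (input) convolution_ring :: "('h \<Rightarrow> 'r) ring" where
  "convolution_ring \<equiv> convolution_algebra scale \<Delta> \<epsilon> smultR"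

lemma convolution_ring_sel:
  "carrier convolution_ring = Collect klinear" "f \<otimes>\<^bsub>convolution_ring\<^esub> g = rconv f g"
  "\<one>\<^bsub>convolution_ring\<^esub> = (\<lambda>h. smultR (\<epsilon> h) 1)" "\<zero>\<^bsub>convolution_ring\<^esub> = (\<lambda>h. 0)"
  "f \<oplus>\<^bsub>convolution_ring\<^esub> g = (\<lambda>h. f h + g h)"
  by (simp_all add: convolution_algebra_def rconv_def[abs_def])

lemma ring_convolution: "ring convolution_ring"
proof (rule ringI)
  have klinear_add: "klinear (\<lambda>h. f h + g h)" if "klinear f" "klinear g" for f g
    using that by (intro klinearI) (simp_all add: klinearD R.scale_right_distrib)
  have klinear_zero: "klinear (\<lambda>h. 0)" by (intro klinearI) simp_all
  have klinear_minus: "klinear (\<lambda>h. - f h)" if "klinear f" for f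
    using that by (intro klinearI) (simp_all add: klinearD)
  show "abelian_group convolution_ring"
    by (rule abelian_groupI)
      (auto simp: convolution_ring_sel klinear_add klinear_zero add.assoc add.commute
        intro!: bexI[of _ "\<lambda>h. - _ h"] klinear_minus)
  show "Group.monoid convolution_ring"
    by (rule monoidI)
      (simp_all add: convolution_ring_sel klinear_rconv klinear_unit rconv_assoc rconv_unit)
qed (simp_all add: convolution_ring_sel rconv_def fun_eq_iff case_prod_unfold distrib_left
    distrib_right sum_list_addf)

end

theorem theorem7:
  fixes smultR :: "'k::field_char_0 \<Rightarrow> 'r::{ring, monoid_mult} \<Rightarrow> 'r"
    and smultH :: "'k \<Rightarrow> 'h::{ring, monoid_mult} \<Rightarrow> 'h"
    and \<Delta> :: "'h \<Rightarrow> ('h \<times> 'h) list"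
    and \<epsilon> :: "'h \<Rightarrow> 'k"
    and antipode :: "'h \<Rightarrow> 'h"
    and A :: "('h \<Rightarrow> 'r) ring"
    and S :: "('h \<Rightarrow> 'r) set"
  assumes "assoc_algebra smultR"
    and "connected_hopf_algebra smultH \<Delta> \<epsilon> antipode"
    and "A = convolution_algebra smultH \<Delta> \<epsilon> smultR"
    and "subring S A"
    and "(\<lambda>f. f 1) ` S = UNIV"
  shows "(prime_ring (ring_of_type :: 'r ring) \<longrightarrow> prime_ring (A\<lparr>carrier := S\<rparr>)) \<and>
         (semiprime_ring (ring_of_type :: 'r ring) \<longrightarrow> semiprime_ring (A\<lparr>carrier := S\<rparr>)) \<and>
         (noncomm_domain (ring_of_type :: 'r ring) \<longrightarrow> noncomm_domain (A\<lparr>carrier := S\<rparr>))"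
proof -
  interpret connected_hopf_convolution smultH \<Delta> \<epsilon> antipode smultR
    using assms(1,2) by (intro connected_hopf_convolution.intro)
  let ?B = "A\<lparr>carrier := S\<rparr>"
  have sel: "f \<otimes>\<^bsub>?B\<^esub> g = rconv f g" "\<one>\<^bsub>?B\<^esub> = (\<lambda>h. smultR (\<epsilon> h) 1)" "\<zero>\<^bsub>?B\<^esub> = (\<lambda>h. 0)" for f g
    unfolding assms(3) by (simp_all add: convolution_ring_sel)
  interpret A: ring A unfolding assms(3) by (rule ring_convolution)
  interpret B: ring ?B by (rule A.subring_is_ring[OF assms(4)])
  have S: "klinear f" if "f \<in> S" for f
    using subringE(1)[OF assms(4)] that unfolding assms(3) convolution_ring_sel by blast
  have one_S: "(\<lambda>h. smultR (\<epsilon> h) 1) \<in> S"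
    using subringE(3)[OF assms(4)] unfolding assms(3) convolution_ring_sel .
  have at_one: "\<exists>s\<in>S. s 1 = r" for r
    using assms(5) by (metis UNIV_I imageE)
  have leading_term: "\<exists>x y w. f x \<noteq> 0 \<and> g y \<noteq> 0 \<and> (f = g \<longrightarrow> x = y) \<and>
      (\<forall>s\<in>S. rconv f (rconv s g) w = 0 \<longrightarrow> f x * s 1 * g y = 0)"
    if "f \<in> S" "f \<noteq> (\<lambda>h. 0)" "g \<in> S" "g \<noteq> (\<lambda>h. 0)" for f g
  proof -
    obtain x\<^sub>0 y\<^sub>0 where "f x\<^sub>0 \<noteq> 0" "g y\<^sub>0 \<noteq> 0" using \<open>f \<noteq> (\<lambda>h. 0)\<close> \<open>g \<noteq> (\<lambda>h. 0)\<close> by blast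
    from rconv_leading_term[OF S[OF that(1)] this(1) S[OF that(3)] this(2)] S show ?thesis by blast
  qed
  have ideals: "\<exists>x y. f x \<noteq> 0 \<and> g y \<noteq> 0 \<and> (f = g \<longrightarrow> x = y) \<and> (\<forall>r. f x * r * g y = 0)"
    if IJ: "ideal I ?B" "ideal J ?B" "ideal_prod ?B I J = {\<zero>\<^bsub>?B\<^esub>}"
      and fg: "f \<in> I" "f \<noteq> \<zero>\<^bsub>?B\<^esub>" "g \<in> J" "g \<noteq> \<zero>\<^bsub>?B\<^esub>" for I J f g
  proof -
    interpret I: ideal I ?B by fact
    interpret J: ideal J ?B by fact
    have "f \<in> S" "g \<in> S" using I.Icarr[OF fg(1)] J.Icarr[OF fg(3)] by simp_all
    then obtain x y w where *: "f x \<noteq> 0" "g y \<noteq> 0" "f = g \<longrightarrow> x = y"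
        "\<And>s. s \<in> S \<Longrightarrow> rconv f (rconv s g) w = 0 \<Longrightarrow> f x * s 1 * g y = 0"
      using leading_term[of f g] fg(2,4) unfolding sel by blast
    have zero: "\<forall>i\<in>I. \<forall>j\<in>J. i \<otimes>\<^bsub>?B\<^esub> j = \<zero>\<^bsub>?B\<^esub>"
      using IJ(3) by (simp only: ideal_prod_eq_zero_iff[OF IJ(1,2)])
    \<comment> \<open>Choose \<open>s\<close> in \<open>S\<close> with \<open>s 1 = r\<close>. The
      ideal \<open>J\<close> absorbs \<open>s\<close> on the left, so \<open>f\<close> annihilates
      \<open>rconv s g\<close>, and the leading term gives the claim.\<close>
    have "f x * r * g y = 0" for r
    proof -
      obtain s where s: "s \<in> S" "s 1 = r" using at_one by blast
      have "rconv s g \<in> J" using J.I_l_closed[OF fg(3), of s] s(1) unfolding sel by simp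
      then have "f \<otimes>\<^bsub>?B\<^esub> rconv s g = \<zero>\<^bsub>?B\<^esub>" by (rule bspec[OF bspec[OF zero fg(1)]])
      then have "rconv f (rconv s g) = (\<lambda>h. 0)" unfolding sel .
      with *(4)[OF s(1)] s(2) show ?thesis by simp
    qed
    with *(1-3) show ?thesis by blast
  qed
  have nonzero: "\<exists>f\<in>I. f \<noteq> \<zero>\<^bsub>?B\<^esub>" if "ideal I ?B" "I \<noteq> {\<zero>\<^bsub>?B\<^esub>}" for I
    using that additive_subgroup.zero_closed[OF ideal.axioms(1)[OF that(1)]] by blast
  have "prime_ring ?B" if R: "prime_ring (ring_of_type :: 'r ring)"
    unfolding prime_ring_def
  proof (intro conjI allI impI B.ring_axioms)
    obtain r :: 'r where "r \<noteq> 0"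
      using R by (auto simp: prime_ring_def ring_of_type_def)
    moreover obtain s where "s \<in> S" "s 1 = r" using at_one by blast
    ultimately show "carrier ?B \<noteq> {\<zero>\<^bsub>?B\<^esub>}" by (auto simp: sel)
  next
    fix I J assume IJ: "ideal I ?B" "ideal J ?B" "ideal_prod ?B I J = {\<zero>\<^bsub>?B\<^esub>}"
    show "I = {\<zero>\<^bsub>?B\<^esub>} \<or> J = {\<zero>\<^bsub>?B\<^esub>}"
    proof (rule ccontr)
      assume "\<not> ?thesis"
      then obtain f g where "f \<in> I" "f \<noteq> \<zero>\<^bsub>?B\<^esub>" "g \<in> J" "g \<noteq> \<zero>\<^bsub>?B\<^esub>"
        using nonzero[OF IJ(1)] nonzero[OF IJ(2)] by blast
      from ideals[OF IJ this] show False using prime_ring_elements[OF R] by blast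
    qed
  qed
  moreover have "semiprime_ring ?B" if R: "semiprime_ring (ring_of_type :: 'r ring)"
    unfolding semiprime_ring_def
  proof (intro conjI allI impI B.ring_axioms)
    fix I assume I: "ideal I ?B" "ideal_prod ?B I I = {\<zero>\<^bsub>?B\<^esub>}"
    show "I = {\<zero>\<^bsub>?B\<^esub>}"
    proof (rule ccontr)
      assume "I \<noteq> {\<zero>\<^bsub>?B\<^esub>}"
      then obtain f where "f \<in> I" "f \<noteq> \<zero>\<^bsub>?B\<^esub>"
        using nonzero[OF I(1)] by blast
      \<comment> \<open>The same map on both sides gives \<open>x = y\<close>, hence a nonzero
        \<open>a\<close> with \<open>a R a = 0\<close>.\<close>
      from ideals[OF I(1) I(1) I(2) this this] show False
        using semiprime_ring_elements[OF R] by blast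
    qed
  qed
  moreover have "noncomm_domain ?B" if R: "noncomm_domain (ring_of_type :: 'r ring)"
    unfolding noncomm_domain_def
  proof (intro conjI ballI impI B.ring_axioms)
    have "(1 :: 'r) \<noteq> 0" using R by (simp add: noncomm_domain_def ring_of_type_def)
    then have "smultR (\<epsilon> 1) 1 \<noteq> 0" by (simp add: counit_one)
    then show "\<one>\<^bsub>?B\<^esub> \<noteq> \<zero>\<^bsub>?B\<^esub>" unfolding sel by metis
  next
    fix f g assume "f \<in> carrier ?B" "g \<in> carrier ?B" "f \<otimes>\<^bsub>?B\<^esub> g = \<zero>\<^bsub>?B\<^esub>"
    then have fg: "f \<in> S" "g \<in> S" "rconv f g = (\<lambda>h. 0)" unfolding sel by simp_all
    show "f = \<zero>\<^bsub>?B\<^esub> \<or> g = \<zero>\<^bsub>?B\<^esub>"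
    proof (rule ccontr)
      assume "\<not> ?thesis"
      then obtain x y w where *: "f x \<noteq> 0" "g y \<noteq> 0"
          "\<And>s. s \<in> S \<Longrightarrow> rconv f (rconv s g) w = 0 \<Longrightarrow> f x * s 1 * g y = 0"
        using leading_term[of f g] fg(1,2) unfolding sel by blast
      \<comment> \<open>Take \<open>s\<close> to be the convolution unit, whose value at 1 is
        1.\<close>
      have "f x * g y = 0"
        using *(3)[OF one_S] fg(3) rconv_unit[OF S[OF fg(2)]] by (simp add: counit_one)
      with R *(1,2) show False by (auto simp: noncomm_domain_def ring_of_type_def)
    qed
  qed
  ultimately show ?thesis by blast
qed

end
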